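(* Let a convergent two-variant continued fraction of class $\mathcal D$ be given (notation and subclasses as in the context), with odd tails $u_n=f^{(2n-1)}$. Let the approximations $u_n'$ of the tails $u_n$ satisfy $$u_n'-u_n=c\,n^{-m/2}+O(n^{-(m+1)/2})\qquad(n\to\infty),$$ where $c\neq0$ is a constant and $m\ge 0$ is an integer such that $$m\ge\begin{cases}0,&\text{if the CF is in }\mathcal D^{=}_{20}\cup\mathcal D^{\neq}_{20},\\ 1,&\text{if the CF is in }\mathcal D^{=}_{10},\\ 2,&\text{otherwise}.\end{cases}$$ Let $$u_n^{+}:=\cfrac{a_n'}{b_n'+\cfrac{a_{n+1}}{b_{n+1}+u_{n+1}'}},\qquad \psi_n':=\frac{a_n'\,a_{n+1}}{\left(a_{n+1}+b_n'b_{n+1}+b_n'u_{n+1}'\right)^2},\qquad \varphi_n':=1+\frac{m}{2n}.$$ Then the approximations $u_n''$ defined by $$u_n'':=\frac{\varphi_n'\,u_n^{+}-\psi_n'\,u_n'}{\varphi_n'-\psi_n'}$$ satisfy $$u_n''-u_n=O\!\left(n^{-m/2-\theta}\right)\qquad(n\to\infty),$$ where $$\theta:=\begin{cases}1,&\text{if the CF is in }\mathcal D^{=}_{10}\cup\mathcal D^{=}_{20},\\ 2,&\text{if the CF is in }\mathcal D^{\neq}_{10}\cup\mathcal D^{\neq}_{20}\cup\widetilde{\mathcal D}_{21},\\ 4,&\text{if the CF is in }\mathcal D_{11}.\end{cases}$$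
   Context: Two-variant continued fractions. A two-variant continued fraction (CF) is $$b_0'+\cfrac{a_1}{b_1+\cfrac{a_1'}{b_1'+\cfrac{a_2}{b_2+\cfrac{a_2'}{b_2'+\cdots}}}}$$ with complex elements whose partial numerators/denominators occur in the order $a_1/b_1,\ a_1'/b_1',\ a_2/b_2,\ a_2'/b_2',\dots$. Its odd tails are $$u_n:=f^{(2n-1)}=\cfrac{a_n'}{b_n'+\cfrac{a_{n+1}}{b_{n+1}+\cfrac{a_{n+1}'}{b_{n+1}'+\cdots}}}\qquad(n\ge1).$$ They satisfy $u_n=\dfrac{a_n'}{b_n'+\dfrac{a_{n+1}}{b_{n+1}+u_{n+1}}}$, hence $X_n=u_n$ is a solution of $$(R)\qquad (b_n'b_{n+1}+a_{n+1})X_n+b_n'X_nX_{n+1}-a_n'X_{n+1}-a_n'b_{n+1}=0 .$$ Elements. The elements have asymptotic expansions as $n\to\infty$ (polynomials in $n$ being a special case); note the shift of index for the unprimed ones: $$a_{n+1}=p_{-2}n^2+p_{-1}n+p_0+p_1n^{-1}+\cdots,\quad a_n'=p_{-2}'n^2+p_{-1}'n+p_0'+p_1'n^{-1}+\cdots,$$ $$b_{n+1}=q_{-2}n^2+q_{-1}n+q_0+q_1n^{-1}+\cdots,\quad b_n'=q_{-2}'n^2+q_{-1}'n+q_0'+q_1'n^{-1}+\cdots.$$ The CF is of class $\mathcal D_{kl}$ ($k\in\{1,2\}$, $l\in\{0,1\}$) if $p_{-k},p_{-k}',q_{-l},q_{-l}'$ are the leading coefficients (i.e. these four are nonzero and all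 coefficients of higher powers of $n$ in the respective expansions vanish). Subclasses. - $\mathcal D^{=}_{10}\subset\mathcal D_{10}$: $p_{-1}=p_{-1}'$ and $q_0q_0'/p_{-1}\notin(-\infty,0]$. - $\mathcal D^{\neq}_{10}\subset\mathcal D_{10}$: $|p_{-1}'|\ne|p_{-1}|$. - $\mathcal D^{=}_{20}\subset\mathcal D_{20}$: $p_{-2}=p_{-2}'$ and $(\beta^2-4\alpha\gamma)/p_{-2}^2\notin(-\infty,0]$, where $\alpha=q_0'$, $\beta=p_{-1}-p_{-1}'-p_{-2}$, $\gamma=-p_{-2}q_0$. - $\mathcal D^{\neq}_{20}\subset\mathcal D_{20}$: $|p_{-2}'|\ne|p_{-2}|$. - $\widetilde{\mathcal D}_{21}\subset\mathcal D_{21}$: the roots $x_0,x_1$ of $x=\dfrac{p_{-2}'}{q_{-1}'+\frac{p_{-2}}{q_{-1}+x}}$ satisfy $\left|\frac{p_{-2}'}{q_{-1}'}-x_0\right|\ne\left|\frac{p_{-2}'}{q_{-1}'}-x_1\right|$. - $\mathcal D:=\mathcal D^{=}_{10}\cup\mathcal D^{\neq}_{10}\cup\mathcal D_{11}\cup\mathcal D^{=}_{20}\cup\mathcal D^{\neq}_{20}\cup\widetilde{\mathcal D}_{21}$. Standing facts about the tails. Equation $(R)$ has two solutions $X_n',X_n''$ with asymptotic expansions of the form $\tau_{-4}n^2+\tau_{-3}n^{3/2}+\tau_{-2}n+\tau_{-1}n^{1/2}+\tau_0+\tau_1n^{-1/2}+\cdots$ (leading coefficients may vanish), and (by a result of Paszkowski)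 $u_n$ is the one among $X_n',X_n''$ for which $\dfrac{X_n\,a_{n+1}}{b_{n+1}+X_{n+1}}$ is asymptotically smaller in modulus.
   Formalization: The bare O-bound makes the claim false (add (-1)^n n^{-(m+1)/2} to the error); it is assumed in addition that u_n'-u_n has an asymptotic expansion through relative order n^{-2}, in powers of n^{-1/2} in D10^= and in steps of n^{-1} in the other classes. *)

theory Defs
  imports "HOL-Analysis.Analysis" "HOL-Library.Landau_Symbols"
begin

subsection \<open>Continued fractions and their tails\<close>

text \<open>
  Canonical (Wallis) numerators and denominators of \<open>\<beta> 0 + \<alpha> 1/(\<beta> 1 + \<alpha> 2/(\<beta> 2 + \<dots>))\<close>;
  the value \<open>\<alpha> 0\<close> is never used.
\<close>

fun cf_num :: "(nat \<Rightarrow> complex) \<Rightarrow> (nat \<Rightarrow> complex) \<Rightarrow> nat \<Rightarrow> complex" where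
  "cf_num \<alpha> \<beta> 0 = \<beta> 0"
| "cf_num \<alpha> \<beta> (Suc 0) = \<beta> 1 * \<beta> 0 + \<alpha> 1"
| "cf_num \<alpha> \<beta> (Suc (Suc k)) =
     \<beta> (Suc (Suc k)) * cf_num \<alpha> \<beta> (Suc k) + \<alpha> (Suc (Suc k)) * cf_num \<alpha> \<beta> k"

fun cf_den :: "(nat \<Rightarrow> complex) \<Rightarrow> (nat \<Rightarrow> complex) \<Rightarrow> nat \<Rightarrow> complex" where
  "cf_den \<alpha> \<beta> 0 = 1"
| "cf_den \<alpha> \<beta> (Suc 0) = \<beta> 1"
| "cf_den \<alpha> \<beta> (Suc (Suc k)) =
     \<beta> (Suc (Suc k)) * cf_den \<alpha> \<beta> (Suc k) + \<alpha> (Suc (Suc k)) * cf_den \<alpha> \<beta> k"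

text \<open>Convergence to a finite value; finitely many approximants may be infinite.\<close>

definition cf_converges_to :: "(nat \<Rightarrow> complex) \<Rightarrow> (nat \<Rightarrow> complex) \<Rightarrow> complex \<Rightarrow> bool" where
  "cf_converges_to \<alpha> \<beta> v \<longleftrightarrow>
     (\<forall>\<^sub>F k in sequentially. cf_den \<alpha> \<beta> k \<noteq> 0) \<and>
     (\<lambda>k. cf_num \<alpha> \<beta> k / cf_den \<alpha> \<beta> k) \<longlonglongrightarrow> v"

text \<open>\<open>v\<close> is the \<open>k\<close>-th tail \<open>\<alpha> (k+1)/(\<beta> (k+1) + \<alpha> (k+2)/(\<beta> (k+2) + \<dots>))\<close>.\<close>

definition cf_tail_value ::
  "(nat \<Rightarrow> complex) \<Rightarrow> (nat \<Rightarrow> complex) \<Rightarrow> nat \<Rightarrow> complex \<Rightarrow> bool" where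
  "cf_tail_value \<alpha> \<beta> k v \<longleftrightarrow>
     cf_converges_to (\<lambda>j. \<alpha> (k + j)) (\<lambda>j. if j = 0 then 0 else \<beta> (k + j)) v"

text \<open>
  The sequence \<open>x' 0, x 1, x' 1, x 2, x' 2, \<dots>\<close>. A two-variant continued fraction has
  partial numerators \<open>two_variant a a'\<close> and partial denominators \<open>two_variant b b'\<close>.
\<close>

definition two_variant :: "(nat \<Rightarrow> complex) \<Rightarrow> (nat \<Rightarrow> complex) \<Rightarrow> nat \<Rightarrow> complex" where
  "two_variant x x' k = (if even k then x' (k div 2) else x ((k + 1) div 2))"


subsection \<open>Asymptotic expansions of the elements, and the classes\<close>

text \<open>\<open>x n \<sim> r (-2) n^2 + r (-1) n + r 0 + r 1 n^(-1) + \<dots>\<close> in the sense of Poincar\'e.\<close>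

definition elem_expansion :: "(nat \<Rightarrow> complex) \<Rightarrow> (int \<Rightarrow> complex) \<Rightarrow> bool" where
  "elem_expansion x r \<longleftrightarrow>
     (\<forall>N::int. (\<lambda>n. x n - (\<Sum>j\<in>{-2..<N}. r j * of_nat n powi (- j)))
                 \<in> O(\<lambda>n. of_nat n powi (- N)))"

definition leading :: "(int \<Rightarrow> complex) \<Rightarrow> int \<Rightarrow> bool" where
  "leading r k \<longleftrightarrow> r (- k) \<noteq> 0 \<and> (\<forall>j\<in>{-2..<- k}. r j = 0)"

text \<open>
  The class predicates take the coefficients \<open>p, p', q, q'\<close> of the expansions of
  \<open>a (n+1), a' n, b (n+1), b' n\<close>.
\<close>

type_synonym coeffs = "int \<Rightarrow> complex"

definition class_D_kl :: "int \<Rightarrow> int \<Rightarrow> coeffs \<Rightarrow> coeffs \<Rightarrow> coeffs \<Rightarrow> coeffs \<Rightarrow> bool" where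
  "class_D_kl k l p p' q q' \<longleftrightarrow> leading p k \<and> leading p' k \<and> leading q l \<and> leading q' l"

definition class_D10_eq :: "coeffs \<Rightarrow> coeffs \<Rightarrow> coeffs \<Rightarrow> coeffs \<Rightarrow> bool" where
  "class_D10_eq p p' q q' \<longleftrightarrow> class_D_kl 1 0 p p' q q' \<and>
     p (-1) = p' (-1) \<and> q 0 * q' 0 / p (-1) \<notin> \<real>\<^sub>\<le>\<^sub>0"

definition class_D10_neq :: "coeffs \<Rightarrow> coeffs \<Rightarrow> coeffs \<Rightarrow> coeffs \<Rightarrow> bool" where
  "class_D10_neq p p' q q' \<longleftrightarrow> class_D_kl 1 0 p p' q q' \<and> norm (p' (-1)) \<noteq> norm (p (-1))"

definition class_D11 :: "coeffs \<Rightarrow> coeffs \<Rightarrow> coeffs \<Rightarrow> coeffs \<Rightarrow> bool" where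
  "class_D11 p p' q q' \<longleftrightarrow> class_D_kl 1 1 p p' q q'"

definition class_D20_eq :: "coeffs \<Rightarrow> coeffs \<Rightarrow> coeffs \<Rightarrow> coeffs \<Rightarrow> bool" where
  "class_D20_eq p p' q q' \<longleftrightarrow> class_D_kl 2 0 p p' q q' \<and>
     p (-2) = p' (-2) \<and>
     (let \<alpha> = q' 0; \<beta> = p (-1) - p' (-1) - p (-2); \<gamma> = - p (-2) * q 0
      in (\<beta>\<^sup>2 - 4 * \<alpha> * \<gamma>) / (p (-2))\<^sup>2 \<notin> \<real>\<^sub>\<le>\<^sub>0)"

definition class_D20_neq :: "coeffs \<Rightarrow> coeffs \<Rightarrow> coeffs \<Rightarrow> coeffs \<Rightarrow> bool" where
  "class_D20_neq p p' q q' \<longleftrightarrow> class_D_kl 2 0 p p' q q' \<and> norm (p' (-2)) \<noteq> norm (p (-2))"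

text \<open>
  The two inequalities in the set below rule out roots that would only be due to division
  by zero being total. A double root \<open>x0 = x1\<close> makes the condition false, as it should.
\<close>

definition class_D21_tilde :: "coeffs \<Rightarrow> coeffs \<Rightarrow> coeffs \<Rightarrow> coeffs \<Rightarrow> bool" where
  "class_D21_tilde p p' q q' \<longleftrightarrow> class_D_kl 2 1 p p' q q' \<and>
     (\<exists>x0 x1. {x. q (-1) + x \<noteq> 0 \<and> q' (-1) + p (-2) / (q (-1) + x) \<noteq> 0 \<and>
                  x = p' (-2) / (q' (-1) + p (-2) / (q (-1) + x))} = {x0, x1} \<and>
              norm (p' (-2) / q' (-1) - x0) \<noteq> norm (p' (-2) / q' (-1) - x1))"

definition class_D :: "coeffs \<Rightarrow> coeffs \<Rightarrow> coeffs \<Rightarrow> coeffs \<Rightarrow> bool" where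
  "class_D p p' q q' \<longleftrightarrow>
     class_D10_eq p p' q q' \<or> class_D10_neq p p' q q' \<or> class_D11 p p' q q' \<or>
     class_D20_eq p p' q q' \<or> class_D20_neq p p' q q' \<or> class_D21_tilde p p' q q'"

definition m_min :: "coeffs \<Rightarrow> coeffs \<Rightarrow> coeffs \<Rightarrow> coeffs \<Rightarrow> nat" where
  "m_min p p' q q' =
     (if class_D20_eq p p' q q' \<or> class_D20_neq p p' q q' then 0
      else if class_D10_eq p p' q q' then 1
      else 2)"

text \<open>Only used within \<open>class_D\<close>, where the last case is \<open>class_D11\<close>.\<close>

definition theta :: "coeffs \<Rightarrow> coeffs \<Rightarrow> coeffs \<Rightarrow> coeffs \<Rightarrow> real" where
  "theta p p' q q' =
     (if class_D10_eq p p' q q' \<or> class_D20_eq p p' q q' then 1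
      else if class_D10_neq p p' q q' \<or> class_D20_neq p p' q q' \<or> class_D21_tilde p p' q q' then 2
      else 4)"


subsection \<open>The improved approximations of the tails\<close>

text \<open>
  In \<open>u_plus\<close>, \<open>a/0 = \<infinity>\<close> and \<open>a'/\<infinity> = 0\<close>, as usual for continued fractions: if \<open>m = 0\<close>,
  the denominator \<open>b (n+1) + w (n+1)\<close> may vanish for infinitely many \<open>n\<close>.
\<close>

definition u_plus ::
  "(nat \<Rightarrow> complex) \<Rightarrow> (nat \<Rightarrow> complex) \<Rightarrow> (nat \<Rightarrow> complex) \<Rightarrow> (nat \<Rightarrow> complex) \<Rightarrow>
   (nat \<Rightarrow> complex) \<Rightarrow> nat \<Rightarrow> complex" where
  "u_plus a b a' b' w n =
     (if b (n + 1) + w (n + 1) = 0 then 0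
      else a' n / (b' n + a (n + 1) / (b (n + 1) + w (n + 1))))"

definition psi ::
  "(nat \<Rightarrow> complex) \<Rightarrow> (nat \<Rightarrow> complex) \<Rightarrow> (nat \<Rightarrow> complex) \<Rightarrow> (nat \<Rightarrow> complex) \<Rightarrow>
   (nat \<Rightarrow> complex) \<Rightarrow> nat \<Rightarrow> complex" where
  "psi a b a' b' w n =
     a' n * a (n + 1) / (a (n + 1) + b' n * b (n + 1) + b' n * w (n + 1))\<^sup>2"

definition phi :: "nat \<Rightarrow> nat \<Rightarrow> complex" where
  "phi m n = 1 + of_nat m / (2 * of_nat n)"

definition improved ::
  "(nat \<Rightarrow> complex) \<Rightarrow> (nat \<Rightarrow> complex) \<Rightarrow> (nat \<Rightarrow> complex) \<Rightarrow> (nat \<Rightarrow> complex) \<Rightarrow>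
   nat \<Rightarrow> (nat \<Rightarrow> complex) \<Rightarrow> nat \<Rightarrow> complex" where
  "improved a b a' b' m w n =
     (phi m n * u_plus a b a' b' w n - psi a b a' b' w n * w n)
       / (phi m n - psi a b a' b' w n)"

abbreviation npow :: "real \<Rightarrow> nat \<Rightarrow> complex" where
  "npow e \<equiv> (\<lambda>n. of_real (real n powr e))"

text \<open>
  In \<open>w n - u n = c n^(-m/2) + O(n^(-(m+1)/2))\<close> the O-term is understood as that of an
  asymptotic expansion; \<open>error_expansion\<close> says that this expansion exists up to the
  relative order \<open>n^(-2)\<close>. A bare bound would not control
  \<open>(w (n+1) - u (n+1)) - (w n - u n)\<close>: with the error \<open>c n^(-m/2) + (-1)^n n^(-(m+1)/2)\<close>
  the asserted improvement fails in every class.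

  The expansion proceeds in powers of \<open>n^(-1/2)\<close> if \<open>half\<close> is true, and of \<open>n^(-1)\<close>
  otherwise. The tails have expansions in integral powers of \<open>n\<close>, except in
  \<open>class_D10_eq\<close>; in the other classes a term \<open>n^(-(m+1)/2)\<close> in the error
  would make the assertion false.
\<close>

definition error_expansion ::
  "bool \<Rightarrow> (nat \<Rightarrow> complex) \<Rightarrow> (nat \<Rightarrow> complex) \<Rightarrow> complex \<Rightarrow> nat \<Rightarrow> bool" where
  "error_expansion half w u c m \<longleftrightarrow>
     (\<exists>d::nat \<Rightarrow> complex. d 0 = c \<and> (\<not> half \<longrightarrow> (\<forall>j. odd j \<longrightarrow> d j = 0)) \<and>
        (\<lambda>n. w n - u n - (\<Sum>j<4. d j * npow (- ((real m + real j) / 2)) n))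
          \<in> O(npow (- ((real m + 4) / 2))))"

end

theory Submission
  imports Defs "HOL-Real_Asymp.Real_Asymp"
begin

text \<open>
  With \<open>e n = u' n - u n\<close> and \<open>D n = a (n+1) + b' n * b (n+1) + b' n * u (n+1)\<close>, exact algebra gives
  \<open>u'' n - u n = \<psi>/(\<phi> - \<psi>) * ((\<phi> * e (n+1) - e n) + \<phi> * (e (n+1))\<^sup>2 * b' n / D n)\<close>. The factor \<open>\<phi>\<close> is
  chosen such that the leading term of \<open>e\<close> cancels in \<open>\<phi> * e (n+1) - e n\<close>. What remains are bounds for
  \<open>\<psi>\<close>, \<open>1/(\<phi> - \<psi>)\<close> and \<open>b'/D\<close>, for which the leading behaviour \<open>u n / g n \<longlonglongrightarrow> x0\<close> of the tails
  with a suitable power \<open>g\<close> of \<open>n\<close> is enough; full asymptotic expansions of \<open>u\<close> are not required.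

  That limit comes from a contraction argument. In the coordinate \<open>(x - x0)/(x - x1)\<close>, with \<open>x0\<close> and
  \<open>x1\<close> the attracting and the repelling fixed point of the limiting Moebius map, the step from
  \<open>u (n+1)\<close> to \<open>u n\<close> is multiplication by a factor of modulus at most \<open>1 - d * t n\<close>, up to errors
  \<open>o(t n)\<close>. Here \<open>t = 1\<close> if the two multipliers differ in modulus, while in the classes
  \<open>class_D10_eq\<close> and \<open>class_D20_eq\<close> the limiting map is the identity and \<open>t n\<close> is \<open>n powr (-1/2)\<close>
  and \<open>1/n\<close>; as the sum of \<open>t n\<close> diverges, all approximants are driven to \<open>x0\<close>.
\<close>

subsection \<open>Approximants of the tails\<close>

definition tail_num :: "(nat \<Rightarrow> complex) \<Rightarrow> (nat \<Rightarrow> complex) \<Rightarrow> nat \<Rightarrow> nat \<Rightarrow> complex" where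
  "tail_num \<alpha> \<beta> k = cf_num (\<lambda>j. \<alpha> (k + j)) (\<lambda>j. if j = 0 then 0 else \<beta> (k + j))"

definition tail_den :: "(nat \<Rightarrow> complex) \<Rightarrow> (nat \<Rightarrow> complex) \<Rightarrow> nat \<Rightarrow> nat \<Rightarrow> complex" where
  "tail_den \<alpha> \<beta> k = cf_den (\<lambda>j. \<alpha> (k + j)) (\<lambda>j. if j = 0 then 0 else \<beta> (k + j))"

lemma tail_num_simps:
  "tail_num \<alpha> \<beta> k 0 = 0"
  "tail_num \<alpha> \<beta> k (Suc 0) = \<alpha> (Suc k)"
  "tail_num \<alpha> \<beta> k (Suc (Suc j)) =
     \<beta> (Suc (Suc (k + j))) * tail_num \<alpha> \<beta> k (Suc j) + \<alpha> (Suc (Suc (k + j))) * tail_num \<alpha> \<beta> k j"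
  by (simp_all add: tail_num_def)

lemma tail_den_simps:
  "tail_den \<alpha> \<beta> k 0 = 1"
  "tail_den \<alpha> \<beta> k (Suc 0) = \<beta> (Suc k)"
  "tail_den \<alpha> \<beta> k (Suc (Suc j)) =
     \<beta> (Suc (Suc (k + j))) * tail_den \<alpha> \<beta> k (Suc j) + \<alpha> (Suc (Suc (k + j))) * tail_den \<alpha> \<beta> k j"
  by (simp_all add: tail_den_def)

text \<open>The defining recurrences append a partial quotient at the inner end. These identities
  peel off the outermost one instead, which passes from tail \<open>k\<close> to tail
  \<open>k + 1\<close>. The induction goes back two indices, as the three-term recurrence
  does.\<close>

lemma tail_num_Suc: "tail_num \<alpha> \<beta> k (Suc j) = \<alpha> (Suc k) * tail_den \<alpha> \<beta> (Suc k) j"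
  and tail_den_Suc: "tail_den \<alpha> \<beta> k (Suc j) =
    \<beta> (Suc k) * tail_den \<alpha> \<beta> (Suc k) j + tail_num \<alpha> \<beta> (Suc k) j"
proof (induction j rule: induct_nat_012)
  case (ge2 i)
  { case 1 show ?case
      unfolding tail_num_simps(3)[of _ _ k "Suc i"] tail_den_simps(3)[of _ _ "Suc k" i] ge2
      by (simp add: algebra_simps)
  next case 2 show ?case
      unfolding tail_den_simps(3)[of _ _ k "Suc i"] tail_den_simps(3)[of _ _ "Suc k" i]
        tail_num_simps(3)[of _ _ "Suc k" i] ge2
      by (simp add: algebra_simps) }
qed (simp_all add: tail_num_simps tail_den_simps)

text \<open>
  Homogeneous coordinates of the image of \<open>\<infinity>\<close>, represented by \<open>(1, 0)\<close>, under the composition of the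
  Moebius maps number \<open>n, \<dots>, n + i - 1\<close>; these are every other approximant of the tail \<open>2 * n - 1\<close>.
\<close>

fun app_num app_den ::
  "(nat \<Rightarrow> complex) \<Rightarrow> (nat \<Rightarrow> complex) \<Rightarrow> (nat \<Rightarrow> complex) \<Rightarrow> (nat \<Rightarrow> complex) \<Rightarrow> nat \<Rightarrow> nat \<Rightarrow> complex"
where
  "app_num a b a' b' n 0 = 1"
| "app_den a b a' b' n 0 = 0"
| "app_num a b a' b' n (Suc i) =
     a' n * (b (n + 1) * app_den a b a' b' (n + 1) i + app_num a b a' b' (n + 1) i)"
| "app_den a b a' b' n (Suc i) =
     (a (n + 1) + b' n * b (n + 1)) * app_den a b a' b' (n + 1) i
       + b' n * app_num a b a' b' (n + 1) i"

text \<open>Peeling twice gives one complete Moebius step, from the tail of index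
  \<open>2 * n + 1\<close> to that of index \<open>2 * n - 1\<close>; \<open>n > 0\<close> rules out
  truncation in the subtraction. The last two claims give the image \<open>a' n / b' n\<close> of
  infinity, the base of the next induction.\<close>

lemma tail_num_den_two_steps:
  fixes a b a' b' :: "nat \<Rightarrow> complex"
  defines "A \<equiv> two_variant a a'" and "B \<equiv> two_variant b b'"
  assumes "n > 0"
  shows "tail_num A B (2 * n - 1) (Suc (Suc j)) =
      a' n * (b (n + 1) * tail_den A B (2 * (n + 1) - 1) j + tail_num A B (2 * (n + 1) - 1) j)"
    and "tail_den A B (2 * n - 1) (Suc (Suc j)) =
      (a (n + 1) + b' n * b (n + 1)) * tail_den A B (2 * (n + 1) - 1) j
        + b' n * tail_num A B (2 * (n + 1) - 1) j"
    and "tail_num A B (2 * n - 1) (Suc 0) = a' n"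
    and "tail_den A B (2 * n - 1) (Suc 0) = b' n"
proof -
  have eq: "Suc (2 * n - 1) = 2 * n" "Suc (2 * n) = 2 * (n + 1) - 1"
    using assms by auto
  have "A (2 * n) = a' n" "B (2 * n) = b' n"
      "A (2 * (n + 1) - 1) = a (n + 1)" "B (2 * (n + 1) - 1) = b (n + 1)"
    by (simp_all add: A_def B_def two_variant_def)
  note AB = this
  show "tail_num A B (2 * n - 1) (Suc (Suc j)) =
      a' n * (b (n + 1) * tail_den A B (2 * (n + 1) - 1) j + tail_num A B (2 * (n + 1) - 1) j)"
    unfolding tail_num_Suc tail_den_Suc eq AB by simp
  show "tail_den A B (2 * n - 1) (Suc (Suc j)) =
      (a (n + 1) + b' n * b (n + 1)) * tail_den A B (2 * (n + 1) - 1) j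
        + b' n * tail_num A B (2 * (n + 1) - 1) j"
    unfolding tail_num_Suc tail_den_Suc eq AB by (simp add: algebra_simps)
  show "tail_num A B (2 * n - 1) (Suc 0) = a' n" "tail_den A B (2 * n - 1) (Suc 0) = b' n"
    unfolding tail_num_Suc tail_den_Suc eq AB by (simp_all add: tail_num_simps tail_den_simps)
qed

text \<open>Starting at infinity, one Moebius step gives \<open>a' n / b' n\<close>, the first
  approximant of the tail, and each further step adds two partial quotients; hence the index
  \<open>2 * i + 1\<close>. The induction varies \<open>n\<close>, because the remaining steps begin
  at \<open>n + 1\<close>.\<close>

lemma app_num_den_eq_tail:
  assumes "n > 0"
  shows "app_num a b a' b' n (Suc i) =
      tail_num (two_variant a a') (two_variant b b') (2 * n - 1) (2 * i + 1)"
    and "app_den a b a' b' n (Suc i) =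
      tail_den (two_variant a a') (two_variant b b') (2 * n - 1) (2 * i + 1)"
  using assms
proof (induction i arbitrary: n)
  case 0
  { case 1 then show ?case using tail_num_den_two_steps[OF 1] by simp
  next case 2 then show ?case using tail_num_den_two_steps[OF 2] by simp }
next
  case (Suc i)
  have e: "2 * Suc i + 1 = Suc (Suc (2 * i + 1))" by simp
  { case 1 then show ?case
      unfolding e tail_num_den_two_steps[OF 1] app_num.simps(2)[of a b a' b' n "Suc i"]
      using Suc[of "n + 1"] by simp
  next case 2 then show ?case
      unfolding e tail_num_den_two_steps[OF 2] app_den.simps(2)[of a b a' b' n "Suc i"]
      using Suc[of "n + 1"] by simp }
qed

text \<open>Convergence of all approximants of the tail passes to the subsequence of odd
  index.\<close>

lemma tail_value_approximants:
  assumes "cf_tail_value (two_variant a a') (two_variant b b') (2 * n - 1) v" "n > 0"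
  shows "\<forall>\<^sub>F i in sequentially. app_den a b a' b' n i \<noteq> 0"
    and "(\<lambda>i. app_num a b a' b' n i / app_den a b a' b' n i) \<longlonglongrightarrow> v"
proof -
  define A where "A = tail_num (two_variant a a') (two_variant b b') (2 * n - 1)"
  define B where "B = tail_den (two_variant a a') (two_variant b b') (2 * n - 1)"
  have conv: "\<forall>\<^sub>F k in sequentially. B k \<noteq> 0" "(\<lambda>k. A k / B k) \<longlonglongrightarrow> v"
    using assms(1)
    by (simp_all add: cf_tail_value_def cf_converges_to_def A_def B_def tail_num_def tail_den_def)
  have sub: "filterlim (\<lambda>i::nat. 2 * i + 1) sequentially sequentially"
    by (rule filterlim_subseq) (auto intro: strict_monoI)
  have "\<forall>\<^sub>F i in sequentially. app_den a b a' b' n (Suc i) \<noteq> 0"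
    using eventually_compose_filterlim[OF conv(1) sub]
    by (simp only: app_num_den_eq_tail[OF assms(2)] B_def)
  then show "\<forall>\<^sub>F i in sequentially. app_den a b a' b' n i \<noteq> 0"
    by (subst (asm) eventually_sequentially_Suc)
  have "(\<lambda>i. app_num a b a' b' n (Suc i) / app_den a b a' b' n (Suc i)) \<longlonglongrightarrow> v"
    using filterlim_compose[OF conv(2) sub]
    by (simp only: app_num_den_eq_tail[OF assms(2)] A_def B_def)
  then show "(\<lambda>i. app_num a b a' b' n i / app_den a b a' b' n i) \<longlonglongrightarrow> v"
    by (rule LIMSEQ_imp_Suc)
qed

text \<open>The Moebius step is exact for the approximants, and \<open>nz\<close> makes it
  continuous at \<open>v'\<close>; letting \<open>i\<close> tend to infinity gives the same relation
  between the tails.\<close>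

lemma tail_value_recurrence:
  assumes v: "cf_tail_value (two_variant a a') (two_variant b b') (2 * n - 1) v" and "n > 0"
    and v': "cf_tail_value (two_variant a a') (two_variant b b') (2 * (n + 1) - 1) v'"
    and nz: "a (n + 1) + b' n * b (n + 1) + b' n * v' \<noteq> 0"
  shows "v = a' n * (b (n + 1) + v') / (a (n + 1) + b' n * b (n + 1) + b' n * v')"
proof -
  define P where "P = app_num a b a' b'"
  define Q where "Q = app_den a b a' b'"
  note l = tail_value_approximants[OF v \<open>n > 0\<close>, folded P_def Q_def]
  have "n + 1 > 0" by simp
  note l' = tail_value_approximants[OF v' this, folded P_def Q_def]
  have "(\<lambda>i. a' n * (b (n + 1) + P (n+1) i / Q (n+1) i) /
        (a (n + 1) + b' n * b (n + 1) + b' n * (P (n+1) i / Q (n+1) i)))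
     \<longlonglongrightarrow> a' n * (b (n + 1) + v') / (a (n + 1) + b' n * b (n + 1) + b' n * v')"
    by (intro tendsto_intros l' nz)
  moreover have "\<forall>\<^sub>F i in sequentially. a' n * (b (n + 1) + P (n+1) i / Q (n+1) i) /
        (a (n + 1) + b' n * b (n + 1) + b' n * (P (n+1) i / Q (n+1) i)) = P n (Suc i) / Q n (Suc i)"
    using l'(1)
  proof eventually_elim
    case (elim i)
    \<comment> \<open>Both homogeneous coordinates contain the factor \<open>Q (n+1) i\<close>,
      eventually nonzero, which cancels in the quotient.\<close>
    have "P n (Suc i) = (a' n * (b (n + 1) + P (n+1) i / Q (n+1) i)) * Q (n+1) i"
      "Q n (Suc i) = (a (n + 1) + b' n * b (n + 1) + b' n * (P (n+1) i / Q (n+1) i)) * Q (n+1) i"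
      using elim by (simp_all add: P_def Q_def field_simps)
    then show ?case using elim by simp
  qed
  ultimately have "(\<lambda>i. P n (Suc i) / Q n (Suc i)) \<longlonglongrightarrow>
      a' n * (b (n + 1) + v') / (a (n + 1) + b' n * b (n + 1) + b' n * v')"
    by (rule Lim_transform_eventually)
  moreover have "(\<lambda>i. P n (Suc i) / Q n (Suc i)) \<longlonglongrightarrow> v"
    using l(2) by (rule LIMSEQ_Suc)
  ultimately show ?thesis using LIMSEQ_unique by blast
qed

subsection \<open>Contraction\<close>

text \<open>By \<open>1 - x \<le> exp (- x)\<close> the product is at most the exponential of
  \<open>- c\<close> times a partial sum of the divergent harmonic series;
  \<open>s k \<le> 1\<close> keeps the factors nonnegative.\<close>

lemma prod_one_minus_harmonic_tendsto_0:
  fixes s :: "nat \<Rightarrow> real"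
  assumes "c > 0" and s: "\<And>k. c / real (Suc (n + k)) \<le> s k" "\<And>k. s k \<le> 1"
  shows "(\<lambda>i. \<Prod>k<i. 1 - s k) \<longlonglongrightarrow> 0"
proof -
  have "\<not> summable (\<lambda>k. 1 / real (Suc (n + k)))"
    using not_summable_harmonic[where 'a = real] summable_iff_shift[of "\<lambda>k. 1 / real k" "Suc n"]
    by (auto simp: field_simps inverse_eq_divide)
  then have "\<exists>i. Z < (\<Sum>k<i. 1 / real (Suc (n + k)))" for Z
    using summableI_nonneg_bounded[of "\<lambda>k. 1 / real (Suc (n + k))" Z]
    by (fastforce simp: not_le)
  moreover have "(\<Sum>k<i. 1 / real (Suc (n + k))) \<le> (\<Sum>k<j. 1 / real (Suc (n + k)))" if "i \<le> j" for i j
    using that by (intro sum_mono2) auto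
  ultimately have "filterlim (\<lambda>i. \<Sum>k<i. 1 / real (Suc (n + k))) at_top sequentially"
    unfolding filterlim_at_top eventually_sequentially by (meson less_imp_le order_trans)
  then have "filterlim (\<lambda>i. c * (\<Sum>k<i. 1 / real (Suc (n + k)))) at_top sequentially"
    using \<open>c > 0\<close> by (rule_tac filterlim_tendsto_pos_mult_at_top[OF tendsto_const]) auto
  then have lim: "(\<lambda>i. exp (- (c * (\<Sum>k<i. 1 / real (Suc (n + k)))))) \<longlonglongrightarrow> 0"
    by (intro filterlim_compose[OF exp_at_bot] filterlim_compose[OF filterlim_uminus_at_bot_at_top])
  show ?thesis
  proof (rule tendsto_sandwich[OF _ _ tendsto_const lim])
    show "\<forall>\<^sub>F i in sequentially. 0 \<le> (\<Prod>k<i. 1 - s k)"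
      using s by (intro always_eventually allI prod_nonneg) auto
    have "1 - s k \<le> exp (- (c * (1 / real (Suc (n + k)))))" for k
      using s(1)[of k] exp_ge_add_one_self[of "- (c * (1 / real (Suc (n + k))))"]
      by (simp del: exp_ge_add_one_self)
    then have "(\<Prod>k<i. 1 - s k) \<le> (\<Prod>k<i. exp (- (c * (1 / real (Suc (n + k))))))" for i
      using s by (intro prod_mono) auto
    then show "\<forall>\<^sub>F i in sequentially. (\<Prod>k<i. 1 - s k) \<le>
        exp (- (c * (\<Sum>k<i. 1 / real (Suc (n + k)))))"
      by (simp add: exp_sum sum_negf sum_distrib_left del: of_nat_Suc flip: sum_negf)
  qed
qed

text \<open>Read \<open>Z0 / Z1\<close> as a coordinate \<open>z\<close>, with \<open>z = 1\<close>
  at the start. A step is \<open>z \<mapsto> (L01 * z - L00) / (L11 * z - L10)\<close>, which is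
  close to multiplication by \<open>- L01 / L10\<close>, of modulus at most
  \<open>1 - d * t n\<close>. The errors \<open>L00\<close> and \<open>L11\<close> are
  \<open>o(t n)\<close> and only prevent \<open>z\<close> from falling below a small threshold,
  while the divergent sum of \<open>t\<close> erases the starting value. Working with products
  instead of quotients lets \<open>Z1 \<noteq> 0\<close> come out of the same induction.\<close>

lemma contraction:
  fixes Z0 Z1 :: "nat \<Rightarrow> nat \<Rightarrow> complex" and L00 L01 L10 L11 \<kappa> :: "nat \<Rightarrow> complex"
    and t :: "nat \<Rightarrow> real"
  assumes init: "\<And>n. Z0 n 0 = Z1 n 0" "\<And>n. Z1 n 0 \<noteq> 0"
    and step: "\<forall>\<^sub>F n in sequentially. \<kappa> n \<noteq> 0 \<and> (\<forall>i.
        Z0 n (Suc i) = \<kappa> n * (L01 n * Z0 (Suc n) i - L00 n * Z1 (Suc n) i) \<and>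
        Z1 n (Suc i) = \<kappa> n * (L11 n * Z0 (Suc n) i - L10 n * Z1 (Suc n) i))"
    and t: "\<forall>\<^sub>F n in sequentially. 1 / real n \<le> t n"
    and "d > 0"
    and main: "\<forall>\<^sub>F n in sequentially. d * t n \<le> 1 \<and> norm (L01 n) \<le> (1 - d * t n) * norm (L10 n)"
    and small: "(\<lambda>n. L00 n / of_real (t n)) \<longlonglongrightarrow> 0" "(\<lambda>n. L11 n / of_real (t n)) \<longlonglongrightarrow> 0"
    and L10: "L10 \<longlonglongrightarrow> l" "l \<noteq> 0"
    and \<epsilon>: "0 < \<epsilon>" "\<epsilon> < 1"
  shows "\<forall>\<^sub>F n in sequentially. \<forall>\<^sub>F i in sequentially.
    Z1 n i \<noteq> 0 \<and> norm (Z0 n i) \<le> 2 * \<epsilon> * norm (Z1 n i)"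
proof -
  \<comment> \<open>Since eventually \<open>norm (L10 n) > norm l / 2\<close>, this makes each of
    the two errors at most \<open>d * t n / 4 * \<epsilon> * norm (L10 n)\<close>.\<close>
  define \<eta> where "\<eta> = d * \<epsilon> * norm l / 8"
  have "\<eta> > 0" using assms by (simp add: \<eta>_def)
  have ev_small: "\<forall>\<^sub>F n in sequentially. norm (L00 n / of_real (t n)) < \<eta>"
    "\<forall>\<^sub>F n in sequentially. norm (L11 n / of_real (t n)) < \<eta>"
    using small \<open>\<eta> > 0\<close> by (auto simp: tendsto_iff)
  have ev_L10: "\<forall>\<^sub>F n in sequentially. norm (L10 n) > norm l / 2"
    using order_tendstoD(1)[OF tendsto_norm[OF L10(1)], of "norm l / 2"] L10(2) by simp
  have "\<forall>\<^sub>F n in sequentially. (\<kappa> n \<noteq> 0 \<and> (\<forall>i.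
        Z0 n (Suc i) = \<kappa> n * (L01 n * Z0 (Suc n) i - L00 n * Z1 (Suc n) i) \<and>
        Z1 n (Suc i) = \<kappa> n * (L11 n * Z0 (Suc n) i - L10 n * Z1 (Suc n) i))) \<and>
      n > 0 \<and> 1 / real n \<le> t n \<and> d * t n \<le> 1 \<and> norm (L01 n) \<le> (1 - d * t n) * norm (L10 n) \<and>
      norm (L00 n) + norm (L11 n) \<le> d * t n / 2 * \<epsilon> * norm (L10 n) \<and> norm (L11 n) < norm (L10 n)"
    using step t main ev_small ev_L10 eventually_gt_at_top[of 0]
  proof eventually_elim
    case (elim n)
    have tn: "t n > 0" using elim by (smt (verit) divide_pos_pos of_nat_0_less_iff)
    have 1: "norm (L00 n) \<le> \<eta> * t n" "norm (L11 n) \<le> \<eta> * t n"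
      using elim tn by (simp_all add: norm_divide field_simps)
    have 2: "\<eta> * t n \<le> d * t n / 4 * \<epsilon> * norm (L10 n)"
      using mult_left_mono[of "norm l / 2" "norm (L10 n)" "d * t n / 4 * \<epsilon>"] elim tn \<open>d > 0\<close> \<epsilon>
      by (simp add: \<eta>_def field_simps)
    have "0 < norm (L10 n)" using elim norm_ge_zero[of l] by linarith
    moreover have "(d * t n) * \<epsilon> \<le> 1" using mult_le_one[of "d * t n" \<epsilon>] elim \<epsilon> by auto
    ultimately have "d * t n / 4 * \<epsilon> * norm (L10 n) < norm (L10 n)"
      using mult_right_mono[of "d * t n * \<epsilon>" 1 "norm (L10 n)"] by simp
    then show ?case using elim 1 2 by auto
  qed
  then obtain n0 where n0: "\<And>n. n \<ge> n0 \<Longrightarrow> \<kappa> n \<noteq> 0 \<and> (\<forall>i.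
        Z0 n (Suc i) = \<kappa> n * (L01 n * Z0 (Suc n) i - L00 n * Z1 (Suc n) i) \<and>
        Z1 n (Suc i) = \<kappa> n * (L11 n * Z0 (Suc n) i - L10 n * Z1 (Suc n) i))"
      "\<And>n. n \<ge> n0 \<Longrightarrow> n > 0 \<and> 1 / real n \<le> t n \<and> d * t n \<le> 1"
      "\<And>n. n \<ge> n0 \<Longrightarrow> norm (L01 n) \<le> (1 - d * t n) * norm (L10 n)"
      "\<And>n. n \<ge> n0 \<Longrightarrow> norm (L00 n) + norm (L11 n) \<le> d * t n / 2 * \<epsilon> * norm (L10 n)"
      "\<And>n. n \<ge> n0 \<Longrightarrow> norm (L11 n) < norm (L10 n)"
    unfolding eventually_sequentially by blast
  have tpos: "t n > 0" if "n \<ge> n0" for n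
    using n0(2)[OF that] by (smt (verit) divide_pos_pos of_nat_0_less_iff)
  \<comment> \<open>With half the rate, the target \<open>(1 - s n) * r + s n * \<epsilon>\<close>
    exceeds the contracted value \<open>(1 - 2 * s n) * r\<close> by at least
    \<open>s n * \<epsilon>\<close>, which is room for the errors.\<close>
  define s where "s n = d * t n / 2" for n
  have s: "0 \<le> s n" "s n \<le> 1" if "n \<ge> n0" for n
    using n0(2)[OF that] tpos[OF that] \<open>d > 0\<close> by (auto simp: s_def)
  \<comment> \<open>The solution of \<open>R n 0 = 1\<close> and
    \<open>R n (Suc i) = (1 - s n) * R (Suc n) i + s n * \<epsilon>\<close>: it starts at the
    initial value of \<open>Z0 / Z1\<close> and tends to \<epsilon>.\<close>
  define R where "R n i = \<epsilon> + (1 - \<epsilon>) * (\<Prod>k<i. 1 - s (n + k))" for n i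
  have R: "0 \<le> R n i" "R n i \<le> 1" if "n \<ge> n0" for n i
  proof -
    have p: "0 \<le> (\<Prod>k<i. 1 - s (n + k))" "(\<Prod>k<i. 1 - s (n + k)) \<le> 1"
      using s that by (auto intro!: prod_nonneg prod_le_1)
    show "0 \<le> R n i" unfolding R_def using p \<epsilon> by (intro add_nonneg_nonneg mult_nonneg_nonneg) auto
    have "(1 - \<epsilon>) * (\<Prod>k<i. 1 - s (n + k)) \<le> (1 - \<epsilon>) * 1" using p \<epsilon> by (intro mult_left_mono) auto
    then show "R n i \<le> 1" unfolding R_def by simp
  qed
  have bound: "Z1 n i \<noteq> 0 \<and> norm (Z0 n i) \<le> R n i * norm (Z1 n i)" if "n \<ge> n0" for n i
    using that
  proof (induction i arbitrary: n)
    case 0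
    then show ?case using init by (simp add: R_def)
  next
    case (Suc i)
    define X where "X = Z0 (Suc n) i"
    define Y where "Y = Z1 (Suc n) i"
    define r where "r = R (Suc n) i"
    have IH: "Y \<noteq> 0" "norm X \<le> r * norm Y" using Suc by (simp_all add: X_def Y_def r_def)
    have r: "0 \<le> r" "r \<le> 1" using R Suc.prems by (auto simp: r_def)
    have Rn: "R n (Suc i) = (1 - s n) * r + s n * \<epsilon>"
      by (simp add: R_def r_def prod.lessThan_Suc_shift algebra_simps del: prod.lessThan_Suc)
    have "norm X \<le> norm Y"
      using IH(2) mult_right_mono[OF r(2) norm_ge_zero[of Y]] by simp
    then have "norm (L11 n * X) \<le> norm (L11 n) * norm Y" by (simp add: norm_mult mult_left_mono)
    \<comment> \<open>This bounds the new \<open>Z1\<close> from below, up to the factor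
      \<open>\<kappa> n\<close>, and later shows that it does not vanish.\<close>
    then have low: "(norm (L10 n) - norm (L11 n)) * norm Y \<le> norm (L11 n * X - L10 n * Y)"
      using norm_triangle_ineq2[of "L10 n * Y" "L11 n * X"]
      by (simp add: norm_minus_commute norm_mult left_diff_distrib)
    have "norm (L01 n * X - L00 n * Y) \<le> norm (L01 n) * norm X + norm (L00 n) * norm Y"
      by (metis norm_mult norm_triangle_ineq4)
    also have "\<dots> \<le> (1 - d * t n) * norm (L10 n) * (r * norm Y) + norm (L00 n) * norm Y"
      using IH n0(2,3)[OF Suc.prems] by (intro add_right_mono mult_mono) auto
    also have "\<dots> = ((1 - d * t n) * norm (L10 n) * r + norm (L00 n)) * norm Y"
      by (simp add: algebra_simps)
    \<comment> \<open>\<open>R n (Suc i) * norm (L10 n)\<close> exceeds the contracted main term by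
      \<open>s n * r * norm (L10 n) + s n * \<epsilon> * norm (L10 n)\<close>; the second summand
      pays for both \<open>L00\<close> and \<open>L11\<close>.\<close>
    also have "\<dots> \<le> (R n (Suc i) * (norm (L10 n) - norm (L11 n))) * norm Y"
    proof (rule mult_right_mono)
      have "R n (Suc i) * norm (L11 n) \<le> norm (L11 n)"
        using R[OF Suc.prems, of "Suc i"] by (simp add: mult_left_le_one_le)
      moreover have "norm (L00 n) + norm (L11 n) \<le> s n * \<epsilon> * norm (L10 n)"
        using n0(4)[OF Suc.prems] by (simp add: s_def)
      moreover have "0 \<le> s n * r * norm (L10 n)" using s[OF Suc.prems] r by simp
      moreover have "R n (Suc i) * norm (L10 n) = (1 - d * t n) * norm (L10 n) * r + s n * r * norm (L10 n)
          + s n * \<epsilon> * norm (L10 n)"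
        unfolding Rn by (simp add: s_def field_simps)
      ultimately show "(1 - d * t n) * norm (L10 n) * r + norm (L00 n) \<le>
          R n (Suc i) * (norm (L10 n) - norm (L11 n))"
        by (simp add: right_diff_distrib)
    qed simp
    also have "\<dots> \<le> R n (Suc i) * norm (L11 n * X - L10 n * Y)"
      using mult_left_mono[OF low R(1)[OF Suc.prems, of "Suc i"]] by (simp add: mult_ac)
    finally have le: "norm (L01 n * X - L00 n * Y) \<le> R n (Suc i) * norm (L11 n * X - L10 n * Y)" .
    have "0 < (norm (L10 n) - norm (L11 n)) * norm Y" using IH n0(5)[OF Suc.prems] by simp
    then have "L11 n * X - L10 n * Y \<noteq> 0" using low by auto
    moreover have "Z0 n (Suc i) = \<kappa> n * (L01 n * X - L00 n * Y)" "Z1 n (Suc i) = \<kappa> n * (L11 n * X - L10 n * Y)"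
      "\<kappa> n \<noteq> 0"
      using n0(1)[OF Suc.prems] by (simp_all add: X_def Y_def)
    ultimately show ?case using mult_left_mono[OF le, of "norm (\<kappa> n)"] by (simp add: norm_mult mult_ac)
  qed
  have lim: "(\<lambda>i. R n i) \<longlonglongrightarrow> \<epsilon>" if "n \<ge> n0" for n
  proof -
    have "(\<lambda>i. \<Prod>k<i. 1 - s (n + k)) \<longlonglongrightarrow> 0"
    proof (rule prod_one_minus_harmonic_tendsto_0[of "d / 2"])
      fix k
      have "1 / real (Suc (n + k)) \<le> 1 / real (n + k)"
        using n0(2)[of "n + k"] that by (intro divide_left_mono) auto
      also have "\<dots> \<le> t (n + k)" using n0(2)[of "n + k"] that by simp
      finally have "1 / real (Suc (n + k)) \<le> t (n + k)" .
      then show "d / 2 / real (Suc (n + k)) \<le> s (n + k)"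
        using mult_left_mono[of "1 / real (Suc (n + k))" "t (n + k)" "d / 2"] \<open>d > 0\<close>
        by (simp add: s_def)
    qed (use that s \<open>d > 0\<close> in auto)
    then have "(\<lambda>i. R n i) \<longlonglongrightarrow> \<epsilon> + (1 - \<epsilon>) * 0"
      unfolding R_def by (intro tendsto_intros)
    then show ?thesis by simp
  qed
  show ?thesis
    unfolding eventually_sequentially[of "\<lambda>n. \<forall>\<^sub>F i in sequentially. _ n i"]
  proof (intro exI[of _ n0] allI impI)
    fix n assume n: "n \<ge> n0"
    show "\<forall>\<^sub>F i in sequentially. Z1 n i \<noteq> 0 \<and> norm (Z0 n i) \<le> 2 * \<epsilon> * norm (Z1 n i)"
    proof (rule eventually_mono)
      show "\<forall>\<^sub>F i in sequentially. R n i < 2 * \<epsilon>"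
        using order_tendstoD(2)[OF lim[OF n], of "2 * \<epsilon>"] \<epsilon> by simp
      fix i assume "R n i < 2 * \<epsilon>"
      then have "R n i * norm (Z1 n i) \<le> 2 * \<epsilon> * norm (Z1 n i)" by (intro mult_right_mono) auto
      then show "Z1 n i \<noteq> 0 \<and> norm (Z0 n i) \<le> 2 * \<epsilon> * norm (Z1 n i)"
        using bound[OF n, of i] by (intro conjI) (blast, rule order_trans[of _ "R n i * norm (Z1 n i)"], blast, assumption)
    qed
  qed
qed

text \<open>
  For rescaled elements and \<open>\<rho> = g n / g (n + 1)\<close>, this is numerator minus \<open>y\<close> times denominator of
  the rescaled Moebius map at \<open>x\<close>.
\<close>

definition step_form ::
  "complex \<Rightarrow> complex \<Rightarrow> complex \<Rightarrow> complex \<Rightarrow> complex \<Rightarrow> complex \<Rightarrow> complex \<Rightarrow> complex" where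
  "step_form \<alpha> \<alpha>' \<beta> \<beta>' \<rho> y x = \<alpha>' * (\<beta> * \<rho> + x) - y * ((\<alpha> + \<beta>' * \<beta>) * \<rho> + \<beta>' * x)"

text \<open>The left side is linear in \<open>(P, Q)\<close>, hence a combination of the forms
  \<open>P - x0 * g' * Q\<close> and \<open>P - x1 * g' * Q\<close>. As in Lagrange interpolation,
  the coefficient of each form is determined by the value at the zero of the other.\<close>

lemma step_form_decomp:
  assumes "x0 \<noteq> x1" and "\<rho> * g' = g"
  shows "(g * h * \<alpha>') * (g * \<beta> * Q + P) - y * g * ((g * h * \<alpha> + h * \<beta>' * (g * \<beta>)) * Q + h * \<beta>' * P) =
    g * h / (x1 - x0) * (step_form \<alpha> \<alpha>' \<beta> \<beta>' \<rho> y x1 * (P - x0 * g' * Q)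
      - step_form \<alpha> \<alpha>' \<beta> \<beta>' \<rho> y x0 * (P - x1 * g' * Q))"
proof -
  have [simp]: "x1 - x0 \<noteq> 0" using assms by simp
  have "(step_form \<alpha> \<alpha>' \<beta> \<beta>' \<rho> y x1 * (P - x0 * g' * Q)
      - step_form \<alpha> \<alpha>' \<beta> \<beta>' \<rho> y x0 * (P - x1 * g' * Q)) =
    (x1 - x0) * (\<alpha>' * (g * \<beta> * Q + P) - y * ((g * \<alpha> + \<beta>' * (g * \<beta>)) * Q + \<beta>' * P))"
    unfolding assms(2)[symmetric] step_form_def by (simp add: algebra_simps)
  then have "g * h / (x1 - x0) * (step_form \<alpha> \<alpha>' \<beta> \<beta>' \<rho> y x1 * (P - x0 * g' * Q)
      - step_form \<alpha> \<alpha>' \<beta> \<beta>' \<rho> y x0 * (P - x1 * g' * Q)) =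
    g * h * (\<alpha>' * (g * \<beta> * Q + P) - y * ((g * \<alpha> + \<beta>' * (g * \<beta>)) * Q + \<beta>' * P))"
    using \<open>x1 - x0 \<noteq> 0\<close> by (simp del: right_minus_eq)
  then show ?thesis by (simp add: algebra_simps)
qed

section \<open>Limits of the rescaled tails\<close>

text \<open>The tails are measured on the scale \<open>g\<close>. With \<open>a\<close> and
  \<open>a'\<close> divided by \<open>g * h\<close>, \<open>b\<close> by \<open>g\<close> and
  \<open>b'\<close> by \<open>h\<close>, the step is again a Moebius step, and
  \<open>g n / g (n + 1)\<close> records the change of scale. \<open>contraction\<close> bounds the
  coordinate \<open>(x - x0) / (x - x1)\<close> of the approximants; \<open>i\<close> to infinity
  carries the bound over to \<open>u n / g n\<close>. The points \<open>x0\<close> and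
  \<open>x1\<close> have to be fixed only up to \<open>o(t n)\<close>.\<close>

lemma tail_limit:
  fixes a b a' b' u g h :: "nat \<Rightarrow> complex" and t :: "nat \<Rightarrow> real" and x0 x1 :: complex
  defines "\<alpha> \<equiv> \<lambda>n. a (n + 1) / (g n * h n)" and "\<alpha>' \<equiv> \<lambda>n. a' n / (g n * h n)"
    and "\<beta> \<equiv> \<lambda>n. b (n + 1) / g n" and "\<beta>' \<equiv> \<lambda>n. b' n / h n"
  defines "L \<equiv> \<lambda>y x n. step_form (\<alpha> n) (\<alpha>' n) (\<beta> n) (\<beta>' n) (g n / g (n + 1)) y x"
  assumes tail: "\<forall>\<^sub>F n in sequentially. cf_tail_value (two_variant a a') (two_variant b b') (2 * n - 1) (u n)"
    and gh: "\<forall>\<^sub>F n in sequentially. g n \<noteq> 0 \<and> h n \<noteq> 0"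
    and "x0 \<noteq> x1"
    and t: "\<forall>\<^sub>F n in sequentially. 1 / real n \<le> t n"
    and "d > 0"
    and main: "\<forall>\<^sub>F n in sequentially. d * t n \<le> 1 \<and> norm (L x0 x1 n) \<le> (1 - d * t n) * norm (L x1 x0 n)"
    and small: "(\<lambda>n. L x0 x0 n / of_real (t n)) \<longlonglongrightarrow> 0" "(\<lambda>n. L x1 x1 n / of_real (t n)) \<longlonglongrightarrow> 0"
    and L10: "L x1 x0 \<longlonglongrightarrow> l" "l \<noteq> 0"
  shows "(\<lambda>n. u n / g n) \<longlonglongrightarrow> x0"
proof -
  define P where "P = app_num a b a' b'"
  define Q where "Q = app_den a b a' b'"
  \<comment> \<open>\<open>Z x0 / Z x1\<close> is the coordinate of the approximant; at
    \<open>i = 0\<close>, that is at infinity, both forms equal 1.\<close>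
  define Z where "Z x n i = P n i - x * g n * Q n i" for x n i
  define \<kappa> where "\<kappa> n = g n * h n / (x1 - x0)" for n
  have g1: "\<forall>\<^sub>F n in sequentially. g (n + 1) \<noteq> 0 \<and> h (n + 1) \<noteq> 0"
    using gh by (simp add: eventually_sequentially_Suc[of "\<lambda>n. g n \<noteq> 0 \<and> h n \<noteq> 0"])
  have step: "\<forall>\<^sub>F n in sequentially. \<kappa> n \<noteq> 0 \<and> (\<forall>i.
        Z x0 n (Suc i) = \<kappa> n * (L x0 x1 n * Z x0 (Suc n) i - L x0 x0 n * Z x1 (Suc n) i) \<and>
        Z x1 n (Suc i) = \<kappa> n * (L x1 x1 n * Z x0 (Suc n) i - L x1 x0 n * Z x1 (Suc n) i))"
    using gh g1
  proof eventually_elim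
    case (elim n)
    have "Z y n (Suc i) = \<kappa> n * (L y x1 n * Z x0 (Suc n) i - L y x0 n * Z x1 (Suc n) i)" for y i
    proof -
      have "a' n = g n * h n * \<alpha>' n" "b (n + 1) = g n * \<beta> n"
        "a (n + 1) = g n * h n * \<alpha> n" "b' n = h n * \<beta>' n"
        using elim by (simp_all add: \<alpha>_def \<alpha>'_def \<beta>_def \<beta>'_def)
      then have "Z y n (Suc i) = (g n * h n * \<alpha>' n) * (g n * \<beta> n * Q (Suc n) i + P (Suc n) i) -
          y * g n * ((g n * h n * \<alpha> n + h n * \<beta>' n * (g n * \<beta> n)) * Q (Suc n) i + h n * \<beta>' n * P (Suc n) i)"
        by (simp add: Z_def P_def Q_def)
      then show ?thesis
        using step_form_decomp[OF \<open>x0 \<noteq> x1\<close>, of "g n / g (n + 1)" "g (n + 1)" "g n"] elim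
        by (simp add: Z_def L_def \<kappa>_def)
    qed
    then show ?case using elim \<open>x0 \<noteq> x1\<close> by (auto simp: \<kappa>_def)
  qed
  have init: "Z x n 0 = 1" for x n by (simp add: Z_def P_def Q_def)
  have close: "\<forall>\<^sub>F n in sequentially. norm (u n / g n - x0) \<le> 2 * \<epsilon> * norm (u n / g n - x1)"
    if "0 < \<epsilon>" "\<epsilon> < 1" for \<epsilon>
  proof -
    have "\<forall>\<^sub>F n in sequentially. \<forall>\<^sub>F i in sequentially.
        Z x1 n i \<noteq> 0 \<and> norm (Z x0 n i) \<le> 2 * \<epsilon> * norm (Z x1 n i)"
      by (rule contraction[OF _ _ step t \<open>d > 0\<close> main small L10 that]) (simp_all add: init)
    then show ?thesis using gh tail eventually_gt_at_top[of 0]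
    proof eventually_elim
      case (elim n)
      note app = tail_value_approximants[OF elim(3,4), folded P_def Q_def]
      have le: "\<forall>\<^sub>F i in sequentially. norm (P n i / Q n i / g n - x0) \<le> 2 * \<epsilon> * norm (P n i / Q n i / g n - x1)"
        using app(1) elim(1)
      proof eventually_elim
        case (elim i)
        have "P n i / Q n i / g n - x = Z x n i / (Q n i * g n)" for x
          using elim \<open>g n \<noteq> 0 \<and> h n \<noteq> 0\<close> by (simp add: Z_def field_simps)
        then show ?case using elim \<open>g n \<noteq> 0 \<and> h n \<noteq> 0\<close>
          by (simp add: norm_divide divide_right_mono)
      qed
      have lim: "(\<lambda>i. P n i / Q n i / g n - x) \<longlonglongrightarrow> u n / g n - x" for x
        using elim by (intro tendsto_diff tendsto_divide app(2) tendsto_const) auto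
      have "(\<lambda>i. norm (P n i / Q n i / g n - x0)) \<longlonglongrightarrow> norm (u n / g n - x0)"
        "(\<lambda>i. 2 * \<epsilon> * norm (P n i / Q n i / g n - x1)) \<longlonglongrightarrow> 2 * \<epsilon> * norm (u n / g n - x1)"
        by (intro tendsto_mult tendsto_const tendsto_norm lim)+
      then show ?case
        using tendsto_le[OF sequentially_bot _ _ le] by blast
    qed
  qed
  show ?thesis
  proof (rule tendstoI)
    fix e :: real assume "e > 0"
    \<comment> \<open>The bound \<open>1/4\<close> lets half of \<open>norm (u n / g n - x0)\<close>
      be absorbed on the left; the other bound makes the remaining
      \<open>4 * \<epsilon> * norm (x0 - x1)\<close> smaller than \<open>e\<close>.\<close>
    define \<epsilon> where "\<epsilon> = min (1/4) (e / (8 * norm (x0 - x1)))"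
    have D: "norm (x0 - x1) > 0" using \<open>x0 \<noteq> x1\<close> by simp
    have \<epsilon>: "0 < \<epsilon>" "\<epsilon> < 1" "\<epsilon> \<le> 1/4" using \<open>e > 0\<close> D by (auto simp: \<epsilon>_def)
    have "\<epsilon> * norm (x0 - x1) \<le> e / 8"
      using D mult_right_mono[of \<epsilon> "e / (8 * norm (x0 - x1))" "norm (x0 - x1)"] by (simp add: \<epsilon>_def)
    then have \<epsilon>e: "4 * \<epsilon> * norm (x0 - x1) < e" using \<open>e > 0\<close> by simp
    show "\<forall>\<^sub>F n in sequentially. dist (u n / g n) x0 < e"
      using close[OF \<epsilon>(1,2)]
    proof eventually_elim
      case (elim n)
      have "norm (u n / g n - x1) \<le> norm (u n / g n - x0) + norm (x0 - x1)"
        using norm_triangle_ineq[of "u n / g n - x0" "x0 - x1"] by simp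
      then have "2 * \<epsilon> * norm (u n / g n - x1) \<le> 2 * \<epsilon> * (norm (u n / g n - x0) + norm (x0 - x1))"
        using \<epsilon> by (intro mult_left_mono) auto
      moreover have "2 * \<epsilon> * norm (u n / g n - x0) \<le> 1/2 * norm (u n / g n - x0)"
        using \<epsilon> by (intro mult_right_mono) auto
      ultimately have "norm (u n / g n - x0) \<le> 4 * \<epsilon> * norm (x0 - x1)"
        using elim by (simp add: algebra_simps)
      then show ?case using \<epsilon>e by (simp add: dist_norm)
    qed
  qed
qed

text \<open>\<open>A + B' * B + B' * x\<close> is the denominator of the limiting map at
  \<open>x\<close>. The multiplier at \<open>x0\<close> is the denominator at \<open>x1\<close>
  divided by that at \<open>x0\<close>, so \<open>less\<close> says that \<open>x0\<close> attracts.
  The contraction rate is bounded away from 0, hence \<open>t = 1\<close>.\<close>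

lemma tail_limit_loxodromic:
  fixes a b a' b' u g h :: "nat \<Rightarrow> complex" and A A' B B' x0 x1 :: complex
  assumes tail: "\<forall>\<^sub>F n in sequentially. cf_tail_value (two_variant a a') (two_variant b b') (2 * n - 1) (u n)"
    and gh: "\<forall>\<^sub>F n in sequentially. g n \<noteq> 0 \<and> h n \<noteq> 0"
    and lims: "(\<lambda>n. a (n + 1) / (g n * h n)) \<longlonglongrightarrow> A" "(\<lambda>n. a' n / (g n * h n)) \<longlonglongrightarrow> A'"
      "(\<lambda>n. b (n + 1) / g n) \<longlonglongrightarrow> B" "(\<lambda>n. b' n / h n) \<longlonglongrightarrow> B'"
      "(\<lambda>n. g n / g (n + 1)) \<longlonglongrightarrow> 1"
    and "x0 \<noteq> x1"
    and roots: "A' * (B + x0) = x0 * (A + B' * B + B' * x0)"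
      "A' * (B + x1) = x1 * (A + B' * B + B' * x1)"
    and less: "norm (A + B' * B + B' * x1) < norm (A + B' * B + B' * x0)"
  shows "(\<lambda>n. u n / g n) \<longlonglongrightarrow> x0"
proof -
  define L where "L y x n = step_form (a (n + 1) / (g n * h n)) (a' n / (g n * h n))
    (b (n + 1) / g n) (b' n / h n) (g n / g (n + 1)) y x" for y x n
  define D0 where "D0 = A + B' * B + B' * x0"
  define D1 where "D1 = A + B' * B + B' * x1"
  have L: "L y x \<longlonglongrightarrow> A' * (B * 1 + x) - y * ((A + B' * B) * 1 + B' * x)" for y x
    unfolding L_def step_form_def by (intro tendsto_intros lims)
  have L00: "L x0 x0 \<longlonglongrightarrow> 0" and L11: "L x1 x1 \<longlonglongrightarrow> 0"
    using L[of x0 x0] L[of x1 x1] by (simp_all add: roots)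
  have L01: "L x0 x1 \<longlonglongrightarrow> (x1 - x0) * D1" and L10: "L x1 x0 \<longlonglongrightarrow> (x0 - x1) * D0"
    using L[of x0 x1] L[of x1 x0] by (simp_all add: roots D0_def D1_def left_diff_distrib)
  have D: "norm D1 < norm D0" using less by (simp add: D0_def D1_def)
  \<comment> \<open>Half of the gap between \<open>norm D1 / norm D0\<close> and 1, so that a strict
    inequality between the limits remains and holds for almost all \<open>n\<close>.\<close>
  define d where "d = (1 - norm D1 / norm D0) / 2"
  have D0: "norm D0 > 0" using D by (smt (verit) norm_ge_zero)
  have d: "0 < d" "d \<le> 1" using D D0 by (auto simp: d_def field_simps)
  have X: "norm (x0 - x1) > 0" using \<open>x0 \<noteq> x1\<close> by simp
  have lt: "norm D1 < (1 - d) * norm D0"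
    using D D0 by (simp add: d_def field_simps)
  have "(\<lambda>n. norm (L x0 x1 n) - (1 - d) * norm (L x1 x0 n)) \<longlonglongrightarrow>
      norm ((x1 - x0) * D1) - (1 - d) * norm ((x0 - x1) * D0)"
    by (intro tendsto_intros L01 L10)
  moreover have "norm ((x1 - x0) * D1) - (1 - d) * norm ((x0 - x1) * D0) < 0"
    using mult_strict_left_mono[OF lt X] by (simp add: norm_mult norm_minus_commute mult_ac)
  ultimately have "\<forall>\<^sub>F n in sequentially. norm (L x0 x1 n) - (1 - d) * norm (L x1 x0 n) < 0"
    by (rule order_tendstoD(2))
  then have main: "\<forall>\<^sub>F n in sequentially. d * (1::real) \<le> 1 \<and> norm (L x0 x1 n) \<le> (1 - d * 1) * norm (L x1 x0 n)"
    by eventually_elim (use d in auto)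
  have "\<forall>\<^sub>F n in sequentially. 1 / real n \<le> 1"
    using eventually_gt_at_top[of 0] by eventually_elim auto
  from tail_limit[OF tail gh \<open>x0 \<noteq> x1\<close> this \<open>d > 0\<close>, folded L_def, OF main _ _ L10]
  show ?thesis using L00 L11 D0 \<open>x0 \<noteq> x1\<close> by simp
qed

text \<open>The two factors are the eigenvalues of the matrix with rows \<open>(A', A' * B)\<close>
  and \<open>(B', A + B' * B)\<close>, with eigenvectors \<open>(x0, 1)\<close> and
  \<open>(x1, 1)\<close>; the right side is its determinant.\<close>

lemma fixed_point_denominators_prod:
  fixes A A' B B' x0 x1 :: complex
  assumes "x0 \<noteq> x1"
    and roots: "A' * (B + x0) = x0 * (A + B' * B + B' * x0)"
      "A' * (B + x1) = x1 * (A + B' * B + B' * x1)"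
  shows "(A + B' * B + B' * x0) * (A + B' * B + B' * x1) = A * A'"
proof -
  have "(x0 - x1) * (B' * (x0 + x1) + (A + B' * B - A')) = 0"
    using roots by algebra
  then have "B' * (x0 + x1) + (A + B' * B - A') = 0" using assms(1) by simp
  then show ?thesis using roots by algebra
qed

text \<open>If the limiting map is the identity, the form tends to \<open>A * (x - y)\<close>, and
  its deviation on the scale \<open>T\<close> matters. The right side arranges this deviation into
  quotients by \<open>T\<close> that have limits.\<close>

lemma step_form_near_identity:
  assumes "T \<noteq> 0"
  shows "(step_form \<alpha> \<alpha>' \<beta> \<beta>' \<rho> y x - A * (x - y)) / T =
    (\<alpha>' - A) / T * x + \<alpha>' * (\<beta> / T) * \<rho>
      - y * ((\<alpha> - A) / T * \<rho> - A * ((1 - \<rho>) / T) + \<beta>' / T * \<beta> * \<rho> + \<beta>' / T * x)"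
proof -
  have "step_form \<alpha> \<alpha>' \<beta> \<beta>' \<rho> y x - A * (x - y) = (\<alpha>' - A) * x + \<alpha>' * \<beta> * \<rho>
      - y * ((\<alpha> - A) * \<rho> - A * (1 - \<rho>) + \<beta>' * \<beta> * \<rho> + \<beta>' * x)"
    by (simp add: step_form_def algebra_simps)
  moreover have "(X * x + \<alpha>' * \<beta> * \<rho> - y * (Y * \<rho> - A * Z + \<beta>' * \<beta> * \<rho> + \<beta>' * x)) / T =
      X / T * x + \<alpha>' * (\<beta> / T) * \<rho> - y * (Y / T * \<rho> - A * (Z / T) + \<beta>' / T * \<beta> * \<rho> + \<beta>' / T * x)"
    for X Y Z
    by (simp add: add_divide_distrib diff_divide_distrib right_diff_distrib distrib_left)
  ultimately show ?thesis by simp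
qed

text \<open>The rescaled map tends to the identity, so attraction shows only in the terms of order
  \<open>t\<close>. At that order a fixed point is a root of the quadratic equation in
  \<open>roots\<close>, where \<open>R\<close> is the drift of the scale \<open>g\<close>. The
  coordinate is multiplied by \<open>1 - t * \<kappa>\<close> to first order, with
  \<open>\<kappa> = B' * (x0 - x1) / A\<close>; a positive real part of \<kappa> makes
  \<open>x0\<close> attracting.\<close>

lemma tail_limit_parabolic:
  fixes a b a' b' u g h :: "nat \<Rightarrow> complex" and t :: "nat \<Rightarrow> real" and A A1 A1' B B' R x0 x1 :: complex
  assumes tail: "\<forall>\<^sub>F n in sequentially. cf_tail_value (two_variant a a') (two_variant b b') (2 * n - 1) (u n)"
    and gh: "\<forall>\<^sub>F n in sequentially. g n \<noteq> 0 \<and> h n \<noteq> 0"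
    and t: "t \<longlonglongrightarrow> 0" "\<forall>\<^sub>F n in sequentially. 1 / real n \<le> t n"
    and lims: "(\<lambda>n. (a (n + 1) / (g n * h n) - A) / of_real (t n)) \<longlonglongrightarrow> A1"
      "(\<lambda>n. (a' n / (g n * h n) - A) / of_real (t n)) \<longlonglongrightarrow> A1'"
      "(\<lambda>n. b (n + 1) / g n / of_real (t n)) \<longlonglongrightarrow> B"
      "(\<lambda>n. b' n / h n / of_real (t n)) \<longlonglongrightarrow> B'"
      "(\<lambda>n. (1 - g n / g (n + 1)) / of_real (t n)) \<longlonglongrightarrow> R"
    and "A \<noteq> 0" "x0 \<noteq> x1"
    and roots: "B' * x0\<^sup>2 + (A1 - A1' - A * R) * x0 = A * B" "B' * x1\<^sup>2 + (A1 - A1' - A * R) * x1 = A * B"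
    and Re: "Re (B' * (x0 - x1) / A) > 0"
  shows "(\<lambda>n. u n / g n) \<longlonglongrightarrow> x0"
proof -
  define \<alpha> where "\<alpha> n = a (n + 1) / (g n * h n)" for n
  define \<alpha>' where "\<alpha>' n = a' n / (g n * h n)" for n
  define \<beta> where "\<beta> n = b (n + 1) / g n" for n
  define \<beta>' where "\<beta>' n = b' n / h n" for n
  define \<rho> where "\<rho> n = g n / g (n + 1)" for n
  define T where "T n = complex_of_real (t n)" for n
  define L where "L y x n = step_form (\<alpha> n) (\<alpha>' n) (\<beta> n) (\<beta>' n) (\<rho> n) y x" for y x n
  have T0: "T \<longlonglongrightarrow> 0" using tendsto_of_real[OF t(1), where 'a = complex] by (simp add: T_def[abs_def])
  have tpos: "\<forall>\<^sub>F n in sequentially. t n > 0"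
    using t(2) eventually_gt_at_top[of 0]
    by eventually_elim (smt (verit) divide_pos_pos of_nat_0_less_iff)
  have Tnz: "\<forall>\<^sub>F n in sequentially. T n \<noteq> 0" using tpos by eventually_elim (simp add: T_def)
  note lims' = lims[folded \<alpha>_def \<alpha>'_def \<beta>_def \<beta>'_def \<rho>_def T_def]
  have to0: "f \<longlonglongrightarrow> c" if "(\<lambda>n. (f n - c) / T n) \<longlonglongrightarrow> k" for f :: "nat \<Rightarrow> complex" and c k
  proof -
    have "(\<lambda>n. (f n - c) / T n * T n + c) \<longlonglongrightarrow> k * 0 + c"
      by (intro tendsto_intros that T0)
    moreover have "\<forall>\<^sub>F n in sequentially. (f n - c) / T n * T n + c = f n"
      using Tnz by eventually_elim simp
    ultimately show ?thesis using Lim_transform_eventually by force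
  qed
  have l: "\<alpha> \<longlonglongrightarrow> A" "\<alpha>' \<longlonglongrightarrow> A" "\<beta> \<longlonglongrightarrow> 0" "\<beta>' \<longlonglongrightarrow> 0"
    using to0[OF lims'(1)] to0[OF lims'(2)] to0[of \<beta> 0 B] to0[of \<beta>' 0 B'] lims'(3,4) by simp_all
  have \<rho>: "\<rho> \<longlonglongrightarrow> 1"
    using to0[of "\<lambda>n. 1 - \<rho> n" 0 R] lims'(5) tendsto_diff[OF tendsto_const[of 1], of "\<lambda>n. 1 - \<rho> n" 0] by simp
  have L1: "L y x \<longlonglongrightarrow> A * (0 * 1 + x) - y * ((A + 0 * 0) * 1 + 0 * x)" for y x
    unfolding L_def step_form_def by (intro tendsto_intros l \<rho>)
  have L: "L y x \<longlonglongrightarrow> A * (x - y)" for y x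
    using L1[of y x] by (simp add: right_diff_distrib mult.commute)
  have L': "(\<lambda>n. (L y x n - A * (x - y)) / T n) \<longlonglongrightarrow>
      A1' * x + A * B - y * (A1 - A * R + B' * x)" for y x
  proof -
    have "(\<lambda>n. (\<alpha>' n - A) / T n * x + \<alpha>' n * (\<beta> n / T n) * \<rho> n
        - y * ((\<alpha> n - A) / T n * \<rho> n - A * ((1 - \<rho> n) / T n) + (\<beta>' n / T n) * \<beta> n * \<rho> n + \<beta>' n / T n * x))
      \<longlonglongrightarrow> A1' * x + A * B * 1 - y * (A1 * 1 - A * R + B' * 0 * 1 + B' * x)"
      by (intro tendsto_intros l \<rho> lims')
    moreover have "\<forall>\<^sub>F n in sequentially. (\<alpha>' n - A) / T n * x + \<alpha>' n * (\<beta> n / T n) * \<rho> n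
        - y * ((\<alpha> n - A) / T n * \<rho> n - A * ((1 - \<rho> n) / T n) + (\<beta>' n / T n) * \<beta> n * \<rho> n + \<beta>' n / T n * x)
        = (L y x n - A * (x - y)) / T n"
      using Tnz by eventually_elim (simp only: L_def, rule step_form_near_identity[symmetric])
    ultimately have "(\<lambda>n. (L y x n - A * (x - y)) / T n) \<longlonglongrightarrow>
        A1' * x + A * B * 1 - y * (A1 * 1 - A * R + B' * 0 * 1 + B' * x)"
      by (rule Lim_transform_eventually)
    then show ?thesis by simp
  qed
  have L00: "(\<lambda>n. L x0 x0 n / T n) \<longlonglongrightarrow> 0"
    using L'[of x0 x0] roots(1) by (simp add: algebra_simps power2_eq_square)
  have L11: "(\<lambda>n. L x1 x1 n / T n) \<longlonglongrightarrow> 0"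
    using L'[of x1 x1] roots(2) by (simp add: algebra_simps power2_eq_square)
  have L10nz: "A * (x0 - x1) \<noteq> 0" using \<open>A \<noteq> 0\<close> \<open>x0 \<noteq> x1\<close> by simp
  \<comment> \<open>Chosen so that \<open>L x0 x1 n = - (1 - T n * K n) * L x1 x0 n\<close>; its
    limit is the first-order rate.\<close>
  define K where "K n = (L x1 x0 n + L x0 x1 n) / (T n * L x1 x0 n)" for n
  define \<kappa> where "\<kappa> = B' * (x0 - x1) / A"
  have "K \<longlonglongrightarrow> \<kappa>"
  proof -
    have "(\<lambda>n. ((L x1 x0 n - A * (x0 - x1)) / T n + (L x0 x1 n - A * (x1 - x0)) / T n) / L x1 x0 n)
      \<longlonglongrightarrow> ((A1' * x0 + A * B - x1 * (A1 - A * R + B' * x0)) + (A1' * x1 + A * B - x0 * (A1 - A * R + B' * x1)))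
          / (A * (x0 - x1))"
      by (intro tendsto_intros L L' L10nz)
    moreover have "\<forall>\<^sub>F n in sequentially.
        ((L x1 x0 n - A * (x0 - x1)) / T n + (L x0 x1 n - A * (x1 - x0)) / T n) / L x1 x0 n = K n"
    proof -
      have "(X - A * (x0 - x1)) + (Y - A * (x1 - x0)) = X + Y" for X Y by (simp add: algebra_simps)
      then show ?thesis by (simp add: K_def flip: add_divide_distrib)
    qed
    ultimately have "K \<longlonglongrightarrow> ((A1' * x0 + A * B - x1 * (A1 - A * R + B' * x0))
        + (A1' * x1 + A * B - x0 * (A1 - A * R + B' * x1))) / (A * (x0 - x1))"
      by (rule Lim_transform_eventually)
    moreover have "((A1' * x0 + A * B - x1 * (A1 - A * R + B' * x0)) + (A1' * x1 + A * B - x0 * (A1 - A * R + B' * x1)))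
          / (A * (x0 - x1)) = \<kappa>"
    proof -
      have "(A1' * x0 + A * B - x1 * (A1 - A * R + B' * x0)) + (A1' * x1 + A * B - x0 * (A1 - A * R + B' * x1))
        = B' * (x0 - x1) * (x0 - x1)"
        using roots by algebra
      then show ?thesis using L10nz \<open>A \<noteq> 0\<close> by (simp only: \<kappa>_def) (simp add: field_simps)
    qed
    ultimately show ?thesis by simp
  qed
  \<comment> \<open>Half of the limiting rate. The other half absorbs the quadratic term of
    \<open>1 - 2 * t * Re K + t^2 * norm K ^ 2\<close>, the squared modulus of
    \<open>1 - t * K\<close>.\<close>
  define d where "d = Re \<kappa> / 2"
  have "d > 0" using Re by (simp add: d_def \<kappa>_def)
  have "(\<lambda>n. - 2 * Re (K n) + t n * (norm (K n))\<^sup>2) \<longlonglongrightarrow> - 2 * Re \<kappa> + 0 * (norm \<kappa>)\<^sup>2"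
    by (intro tendsto_intros \<open>K \<longlonglongrightarrow> \<kappa>\<close> t)
  moreover have "- 2 * Re \<kappa> + 0 * (norm \<kappa>)\<^sup>2 < - 2 * d" using \<open>d > 0\<close> by (simp add: d_def)
  ultimately have ev1: "\<forall>\<^sub>F n in sequentially. - 2 * Re (K n) + t n * (norm (K n))\<^sup>2 < - 2 * d"
    by (rule order_tendstoD(2))
  have ev2: "\<forall>\<^sub>F n in sequentially. d * t n < 1"
    using order_tendstoD(2)[OF tendsto_mult[OF tendsto_const[of d] t(1)], of 1] by simp
  have ev3: "\<forall>\<^sub>F n in sequentially. L x1 x0 n \<noteq> 0"
    using tendsto_imp_eventually_ne[OF L L10nz] .
  have main: "\<forall>\<^sub>F n in sequentially. d * t n \<le> 1 \<and> norm (L x0 x1 n) \<le> (1 - d * t n) * norm (L x1 x0 n)"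
    using ev1 ev2 ev3 tpos
  proof eventually_elim
    case (elim n)
    have "L x0 x1 n = - ((1 - of_real (t n) * K n) * L x1 x0 n)"
      using elim by (simp add: K_def T_def field_simps)
    then have eq: "norm (L x0 x1 n) = norm (1 - of_real (t n) * K n) * norm (L x1 x0 n)"
      by (simp add: norm_mult)
    have "(norm (1 - of_real (t n) * K n))\<^sup>2 = 1 + t n * (- 2 * Re (K n) + t n * (norm (K n))\<^sup>2)"
      by (simp add: cmod_power2) (simp add: power2_eq_square algebra_simps)
    also have "\<dots> \<le> 1 + t n * (- 2 * d)"
      using elim by (intro add_left_mono mult_left_mono) auto
    also have "\<dots> \<le> 1 + t n * (- 2 * d) + (d * t n)\<^sup>2" by simp
    also have "\<dots> = (1 - d * t n)\<^sup>2" by (simp add: power2_diff)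
    finally have "(norm (1 - of_real (t n) * K n))\<^sup>2 \<le> (1 - d * t n)\<^sup>2" .
    moreover have "0 \<le> 1 - d * t n" using elim(2) by simp
    ultimately have "norm (1 - of_real (t n) * K n) \<le> 1 - d * t n" by (rule power2_le_imp_le)
    then have "norm (L x0 x1 n) \<le> (1 - d * t n) * norm (L x1 x0 n)"
      unfolding eq by (rule mult_right_mono) simp
    then show ?case using elim(2) by simp
  qed
  from tail_limit[OF tail gh \<open>x0 \<noteq> x1\<close> t(2) \<open>d > 0\<close>,
      folded \<alpha>_def \<alpha>'_def \<beta>_def \<beta>'_def \<rho>_def, folded L_def T_def, OF main L00 L11 L L10nz]
  show ?thesis .
qed

subsection \<open>Powers of n and asymptotic expansions\<close>

lemma npow_mult: "npow r n * npow s n = npow (r + s) n"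
  by (simp add: powr_add)

lemma npow_minus: "npow (- r) n = 1 / npow r n"
  by (simp add: powr_minus_divide)

lemma npow_eq_powi: "n > 0 \<Longrightarrow> npow (of_int k) n = of_nat n powi k"
proof -
  assume "n > 0"
  have "real n powr of_int k = real n powi k"
    using \<open>n > 0\<close> by (simp add: powr_real_of_int')
  then show ?thesis by simp
qed

lemma npow_tendsto_0: "r < 0 \<Longrightarrow> npow r \<longlonglongrightarrow> 0"
proof -
  assume "r < 0"
  then have "(\<lambda>n. real n powr r) \<longlonglongrightarrow> 0" by real_asymp
  from tendsto_of_real[OF this, where 'a = complex] show ?thesis by simp
qed

lemma npow_mono_bigo: "r \<le> s \<Longrightarrow> npow r \<in> O(npow s)"
proof (rule bigoI[where c = 1])
  assume "r \<le> s"
  show "\<forall>\<^sub>F n in sequentially. norm (npow r n) \<le> 1 * norm (npow s n)"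
    using eventually_ge_at_top[of 1]
  proof eventually_elim
    case (elim n)
    have "real n powr r \<le> real n powr s" using elim \<open>r \<le> s\<close> by (intro powr_mono) auto
    then show ?case by simp
  qed
qed

lemma bigo_npowI:
  assumes "(\<lambda>n. f n * npow (- r) n) \<longlonglongrightarrow> l"
  shows "f \<in> O(npow r)"
proof -
  have "\<forall>\<^sub>F n in sequentially. npow r n \<noteq> 0"
    using eventually_gt_at_top[of 0] by eventually_elim simp
  then show ?thesis
    using assms by (intro bigoI_tendsto[where c = l]) (simp_all add: npow_minus)
qed

lemma bigo_npow_tendsto_0:
  assumes "f \<in> O(npow s)" "s < 0"
  shows "f \<longlonglongrightarrow> 0"
proof -
  have "npow s \<in> o(\<lambda>_. 1 :: complex)"
    by (intro smalloI_tendsto) (use npow_tendsto_0[OF assms(2)] in auto)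
  with assms(1) have "f \<in> o(\<lambda>_. 1 :: complex)" by (rule landau_o.big_small_trans)
  then show ?thesis using smalloD_tendsto by fastforce
qed

lemma eventually_npow_nonzero: "\<forall>\<^sub>F n in sequentially. npow r n \<noteq> 0 \<and> npow s n \<noteq> 0"
  using eventually_gt_at_top[of 0] by eventually_elim simp

text \<open>The defining bound at \<open>M + 1\<close> isolates the coefficient \<open>r M\<close>.
  An expansion has no terms of index below -2, which explains the limit 0 in that case.\<close>

lemma elem_expansion_tendsto:
  assumes "elem_expansion x r"
  shows "(\<lambda>n. (x n - (\<Sum>j\<in>{-2..<M}. r j * npow (- of_int j) n)) * npow (of_int M) n)
           \<longlonglongrightarrow> (if M \<ge> -2 then r M else 0)"
proof -
  define f where "f n = x n - (\<Sum>j\<in>{-2..<M+1}. r j * of_nat n powi (- j))" for n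
  have "f \<in> O(\<lambda>n. of_nat n powi (- (M + 1)))"
    using assms unfolding elem_expansion_def f_def by blast
  then have "(\<lambda>n. f n * npow (of_int M) n) \<in> O(\<lambda>n. of_nat n powi (- (M + 1)) * npow (of_int M) n)"
    by (intro landau_o.big.mult) auto
  also have "(\<lambda>n. of_nat n powi (- (M + 1)) * npow (of_int M) n) \<in> \<Theta>(npow (-1))"
  proof (rule bigthetaI_cong)
    show "\<forall>\<^sub>F n in sequentially. of_nat n powi (- (M + 1)) * npow (of_int M) n = npow (-1) n"
      using eventually_gt_at_top[of 0]
    proof eventually_elim
      case (elim n)
      show ?case unfolding npow_eq_powi[OF elim, symmetric] npow_mult by simp
    qed
  qed
  finally have "(\<lambda>n. f n * npow (of_int M) n) \<in> O(npow (-1))" .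
  then have lim: "(\<lambda>n. f n * npow (of_int M) n) \<longlonglongrightarrow> 0"
    by (rule bigo_npow_tendsto_0) simp
  have "(\<lambda>n. f n * npow (of_int M) n + (if M \<ge> -2 then r M else 0)) \<longlonglongrightarrow>
      0 + (if M \<ge> -2 then r M else 0)"
    by (intro tendsto_intros lim)
  moreover have "\<forall>\<^sub>F n in sequentially. f n * npow (of_int M) n + (if M \<ge> -2 then r M else 0) =
      (x n - (\<Sum>j\<in>{-2..<M}. r j * npow (- of_int j) n)) * npow (of_int M) n"
    using eventually_gt_at_top[of 0]
  proof eventually_elim
    case (elim n)
    have S: "(\<Sum>j\<in>{-2..<M}. r j * npow (- of_int j) n) = (\<Sum>j\<in>{-2..<M}. r j * of_nat n powi (- j))"
      by (intro sum.cong refl) (simp flip: npow_eq_powi[OF elim])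
    have "f n = x n - (\<Sum>j\<in>{-2..<M}. r j * npow (- of_int j) n)
        - (if M \<ge> -2 then r M * npow (- of_int M) n else 0)"
    proof (cases "M \<ge> -2")
      case True
      then have "{-2..<M+1} = insert M {-2..<M}" by auto
      then have "f n = x n - (r M * of_nat n powi (- M) + (\<Sum>j\<in>{-2..<M}. r j * of_nat n powi (- j)))"
        unfolding f_def by simp
      also have "of_nat n powi (- M) = npow (- of_int M) n" using npow_eq_powi[OF elim, of "-M"] by simp
      finally show ?thesis using True S by simp
    qed (auto simp: f_def)
    then have *: "f n + (if M \<ge> -2 then r M * npow (- of_int M) n else 0)
        = x n - (\<Sum>j\<in>{-2..<M}. r j * npow (- of_int j) n)" by simp
    have "npow (- real_of_int M) n * npow (real_of_int M) n = 1"
      using elim by (simp add: npow_minus)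
    then show ?case
      unfolding *[symmetric] by (simp only: distrib_right mult.assoc if_distrib[of "\<lambda>x. x * _"]
        mult_1_right mult_zero_left cong: if_cong)
  qed
  ultimately show ?thesis by (auto dest: Lim_transform_eventually)
qed

text \<open>All terms before index \<open>- k\<close> vanish, so the preceding limits at
  \<open>- k\<close> and \<open>1 - k\<close> give the leading coefficient and the first
  correction.\<close>

lemma expansion_leading:
  assumes "elem_expansion x r" "leading r k"
  shows "(\<lambda>n. x n * npow (- of_int k) n) \<longlonglongrightarrow> (if k \<le> 2 then r (- k) else 0)"
    and "k \<le> 2 \<Longrightarrow> (\<lambda>n. (x n * npow (- of_int k) n - r (- k)) * of_nat n) \<longlonglongrightarrow> r (1 - k)"
proof -
  have z: "(\<Sum>j\<in>{-2..<-k}. r j * npow (- of_int j) n) = 0" for n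
    using assms(2) by (intro sum.neutral) (auto simp: leading_def)
  show "(\<lambda>n. x n * npow (- of_int k) n) \<longlonglongrightarrow> (if k \<le> 2 then r (- k) else 0)"
    using elem_expansion_tendsto[OF assms(1), of "-k"] by (simp add: z)
  assume "k \<le> 2"
  then have "{-2..<1-k} = insert (-k) {-2..<-k}" by auto
  then have "(\<lambda>n. (x n - r (- k) * npow (of_int k) n) * npow (1 - of_int k) n) \<longlonglongrightarrow> r (1 - k)"
    using elem_expansion_tendsto[OF assms(1), of "1-k"] \<open>k \<le> 2\<close> by (simp add: z)
  moreover have "\<forall>\<^sub>F n in sequentially. (x n - r (- k) * npow (of_int k) n) * npow (1 - of_int k) n =
      (x n * npow (- of_int k) n - r (- k)) * of_nat n"
    using eventually_gt_at_top[of 0]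
  proof eventually_elim
    case (elim n)
    have "npow (1 - of_int k) n = npow (- of_int k) n * of_nat n"
      using npow_mult[where r = "- real_of_int k" and n = n and s = 1] elim by simp
    then show ?case using elim by (simp add: npow_minus algebra_simps)
  qed
  ultimately show "(\<lambda>n. (x n * npow (- of_int k) n - r (- k)) * of_nat n) \<longlonglongrightarrow> r (1 - k)"
    by (rule Lim_transform_eventually)
qed

lemma expansion_order_1:
  assumes "elem_expansion x r" "leading r 1"
  shows "(\<lambda>n. x n * npow (- 1) n) \<longlonglongrightarrow> r (-1)"
    and "(\<lambda>n. (x n * npow (- 1) n - r (-1)) * of_nat n) \<longlonglongrightarrow> r 0"
  using expansion_leading[OF assms] by simp_all

lemma expansion_order_2:
  assumes "elem_expansion x r" "leading r 2"
  shows "(\<lambda>n. x n * npow (- 2) n) \<longlonglongrightarrow> r (-2)"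
    and "(\<lambda>n. (x n * npow (- 2) n - r (-2)) * of_nat n) \<longlonglongrightarrow> r (-1)"
  using expansion_leading[OF assms] by simp_all

lemma expansion_order_0:
  assumes "elem_expansion x r" "leading r 0"
  shows "x \<longlonglongrightarrow> r 0"
proof -
  have "(\<lambda>n. x n * npow (- of_int 0) n) \<longlonglongrightarrow> r 0"
    using expansion_leading(1)[OF assms] by simp
  moreover have "\<forall>\<^sub>F n in sequentially. x n * npow (- of_int 0) n = x n"
    using eventually_gt_at_top[of 0] by eventually_elim simp
  ultimately show ?thesis by (rule Lim_transform_eventually)
qed

lemma npow_ratio: "(\<lambda>n. npow \<gamma> n / npow \<gamma> (n + 1)) \<longlonglongrightarrow> 1"
proof -
  have "(\<lambda>n. real n powr \<gamma> / real (n + 1) powr \<gamma>) \<longlonglongrightarrow> 1" by real_asymp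
  from tendsto_of_real[OF this, where 'a = complex] show ?thesis by simp
qed

text \<open>The relative change of the scale in one step is \<gamma> / n to first order; this is
  where the drift constant \<open>R\<close> of the parabolic case comes from.\<close>

lemma npow_ratio': "(\<lambda>n. (1 - npow \<gamma> n / npow \<gamma> (n + 1)) * of_nat n) \<longlonglongrightarrow> of_real \<gamma>"
proof -
  have "(\<lambda>n. (1 - real n powr \<gamma> / real (n + 1) powr \<gamma>) * real n) \<longlonglongrightarrow> \<gamma>" by real_asymp
  from tendsto_of_real[OF this, where 'a = complex] show ?thesis by simp
qed

text \<open>This is the reason for the choice of \<open>phi\<close>: passing from \<open>n\<close>
  to \<open>n + 1\<close> multiplies the power by \<open>1 - m / (2 * n) + O(1 / n^2)\<close>, and
  \<open>phi m n\<close> cancels the term of order \<open>1 / n\<close>.\<close>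

lemma phi_shift_leading:
  "(\<lambda>n. phi m n * npow (- (real m / 2)) (n + 1) - npow (- (real m / 2)) n) \<in> O(npow (- (real m / 2) - 2))"
proof -
  have "(\<lambda>n. (1 + real m / (2 * real n)) * real (n + 1) powr (- (real m / 2)) - real n powr (- (real m / 2)))
      \<in> O(\<lambda>n. real n powr (- (real m / 2) - 2))" (is "?f \<in> O(?g)")
    by real_asymp
  then have "(\<lambda>n. complex_of_real (?f n)) \<in> O(\<lambda>n. complex_of_real (?g n))"
    by (subst landau_o.big.of_real_iff)
  then show ?thesis by (simp add: phi_def)
qed

text \<open>For a general exponent the terms of order \<open>1 / n\<close> need not cancel, and a
  single power of \<open>n\<close> is gained.\<close>

lemma phi_shift:
  "(\<lambda>n. phi m n * npow (- s) (n + 1) - npow (- s) n) \<in> O(npow (- s - 1))"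
proof -
  have "(\<lambda>n. (1 + real m / (2 * real n)) * real (n + 1) powr (- s) - real n powr (- s))
      \<in> O(\<lambda>n. real n powr (- s - 1))" (is "?f \<in> O(?g)")
    by real_asymp
  then have "(\<lambda>n. complex_of_real (?f n)) \<in> O(\<lambda>n. complex_of_real (?g n))"
    by (subst landau_o.big.of_real_iff)
  then show ?thesis by (simp add: phi_def)
qed

lemma phi_tendsto_1: "phi m \<longlonglongrightarrow> 1"
proof -
  have "(\<lambda>n. 1 + real m / (2 * real n)) \<longlonglongrightarrow> 1" by real_asymp
  from tendsto_of_real[OF this, where 'a = complex] show ?thesis
    by (simp add: phi_def[abs_def])
qed

lemma npow_shift_bigo: "(\<lambda>n. npow s (n + 1)) \<in> O(npow s)"
proof -
  have "(\<lambda>n. real (n + 1) powr s) \<in> O(\<lambda>n. real n powr s)" by real_asymp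
  then have "(\<lambda>n. complex_of_real (real (n + 1) powr s)) \<in> O(\<lambda>n. complex_of_real (real n powr s))"
    by (subst landau_o.big.of_real_iff)
  then show ?thesis .
qed

subsection \<open>The error of the improved approximations\<close>

text \<open>The leading term of the error gains two powers of \<open>n\<close>. The term number
  \<open>j\<close> is smaller by \<open>j / 2\<close> powers and gains one more: \<open>3/2\<close>
  in total for \<open>j = 1\<close>, which occurs only if \<open>half\<close> holds, and at least 2
  for \<open>j \<ge> 2\<close>. The remainder of the expansion is already two powers
  smaller.\<close>

lemma error_shift:
  assumes "error_expansion half w u c m"
  shows "(\<lambda>n. phi m n * (w (n + 1) - u (n + 1)) - (w n - u n))
    \<in> O(npow (- (real m / 2) - (if half then 3/2 else 2)))" (is "_ \<in> O(npow ?s)")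
proof -
  obtain d where d: "\<not> half \<longrightarrow> (\<forall>j. odd j \<longrightarrow> d j = 0)"
    and r: "(\<lambda>n. w n - u n - (\<Sum>j<4. d j * npow (- ((real m + real j) / 2)) n))
          \<in> O(npow (- ((real m + 4) / 2)))"
    using assms unfolding error_expansion_def by blast
  define r where "r n = w n - u n - (\<Sum>j<4. d j * npow (- ((real m + real j) / 2)) n)" for n
  define T where "T j n = d j * (phi m n * npow (- ((real m + real j) / 2)) (n + 1)
    - npow (- ((real m + real j) / 2)) n)" for j n
  have "r \<in> O(npow (- ((real m + 4) / 2)))" using r by (simp add: r_def[abs_def])
  also have "npow (- ((real m + 4) / 2)) \<in> O(npow ?s)" by (intro npow_mono_bigo) (auto simp: field_simps)
  finally have r: "r \<in> O(npow ?s)" .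
  have "(\<lambda>n. r (n + 1)) \<in> O(\<lambda>n. npow ?s (n + 1))"
    by (rule landau_o.big.compose[OF r]) (rule filterlim_add_const_nat_at_top)
  then have r1: "(\<lambda>n. r (n + 1)) \<in> O(npow ?s)" using npow_shift_bigo by (rule landau_o.big_trans)
  have phi: "phi m \<in> O(\<lambda>_. 1)"
    using phi_tendsto_1 by (intro bigoI_tendsto[where c = 1]) auto
  have "T j \<in> O(npow ?s)" for j
  proof (cases "j = 0 \<or> (\<not> half \<and> odd j)")
    case True
    have le: "npow (- (real m / 2) - 2) \<in> O(npow ?s)" by (intro npow_mono_bigo) auto
    have "T 0 \<in> O(npow (- (real m / 2) - 2))" using phi_shift_leading[of m] by (simp add: T_def[abs_def])
    from landau_o.big_trans[OF this le] show ?thesis using True d by (auto simp: T_def[abs_def])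
  next
    case False
    then have "real j / 2 + 1 \<ge> (if half then 3/2 else 2)"
      by (auto elim!: evenE)
    then have le: "npow (- ((real m + real j) / 2) - 1) \<in> O(npow ?s)"
      by (intro npow_mono_bigo) (auto simp: field_simps split: if_splits)
    have "T j \<in> O(npow (- ((real m + real j) / 2) - 1))"
      using phi_shift[of m "(real m + real j) / 2"] by (simp add: T_def[abs_def])
    from landau_o.big_trans[OF this le] show ?thesis .
  qed
  then have "(\<lambda>n. (\<Sum>j<4. T j n) + phi m n * r (n + 1) - r n) \<in> O(npow ?s)"
    using landau_o.big.mult[OF phi r1] r
    by (intro sum_in_bigo big_sum_in_bigo) auto
  also have "(\<lambda>n. (\<Sum>j<4. T j n) + phi m n * r (n + 1) - r n) =
      (\<lambda>n. phi m n * (w (n + 1) - u (n + 1)) - (w n - u n))"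
    by (auto simp: fun_eq_iff r_def T_def algebra_simps sum_distrib_left sum_subtractf)
  finally show ?thesis .
qed

text \<open>With \<open>e\<close> the error at \<open>n + 1\<close>,
  \<open>D w n = D u n + b' n * e\<close>, so \<open>u_plus\<close> differs from \<open>u n\<close>
  by \<open>psi\<close> times \<open>e + e^2 * b' n / D u n\<close>. The weights in
  \<open>improved\<close> turn the linear part into \<open>phi * e\<close> minus the error at
  \<open>n\<close> and multiply the quadratic part by \<open>phi\<close>.\<close>

lemma improved_minus_tail:
  fixes a b a' b' w u :: "nat \<Rightarrow> complex"
  defines "D \<equiv> \<lambda>v n. a (n + 1) + b' n * b (n + 1) + b' n * v (n + 1)"
  assumes u: "u n = a' n * (b (n + 1) + u (n + 1)) / D u n"
    and nz: "D u n \<noteq> 0" "D w n \<noteq> 0" "phi m n \<noteq> psi a b a' b' w n"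
  shows "improved a b a' b' m w n - u n =
    psi a b a' b' w n / (phi m n - psi a b a' b' w n) *
      ((phi m n * (w (n + 1) - u (n + 1)) - (w n - u n))
        + phi m n * ((w (n + 1) - u (n + 1)) * (w (n + 1) - u (n + 1))) * (b' n / D u n))"
proof -
  define e where "e = w (n + 1) - u (n + 1)"
  define \<psi> where "\<psi> = psi a b a' b' w n"
  \<comment> \<open>If the inner denominator vanishes, the value 0 prescribed in
    \<open>u_plus\<close> agrees with this cancelled form.\<close>
  have up: "u_plus a b a' b' w n = a' n * (b (n + 1) + w (n + 1)) / D w n"
  proof (cases "b (n + 1) + w (n + 1) = 0")
    case False
    then have "b' n + a (n + 1) / (b (n + 1) + w (n + 1)) = D w n / (b (n + 1) + w (n + 1))"
      by (simp add: D_def field_simps)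
    then show ?thesis using False by (simp add: u_plus_def)
  qed (simp add: u_plus_def)
  have \<psi>: "\<psi> = a' n * a (n + 1) / (D w n * D w n)"
    by (simp add: \<psi>_def psi_def D_def power2_eq_square)
  have Dw: "D w n = D u n + b' n * e" by (simp add: D_def e_def algebra_simps)
  have "(b (n + 1) + w (n + 1)) * D u n - (b (n + 1) + u (n + 1)) * D w n = a (n + 1) * e"
    by (simp add: D_def e_def algebra_simps)
  moreover have "a' n * (b (n + 1) + w (n + 1)) / D w n - a' n * (b (n + 1) + u (n + 1)) / D u n =
      a' n * ((b (n + 1) + w (n + 1)) * D u n - (b (n + 1) + u (n + 1)) * D w n) / (D w n * D u n)"
    using nz by (simp add: field_simps)
  ultimately have "u_plus a b a' b' w n - u n = a' n * (a (n + 1) * e) / (D w n * D u n)"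
    unfolding up u by simp
  also have "\<dots> = \<psi> * (D w n / D u n) * e" using nz by (simp add: \<psi>)
  also have "\<dots> = \<psi> * (e + e * e * (b' n / D u n))"
    using nz(1) by (simp add: Dw field_simps)
  finally have diff: "u_plus a b a' b' w n = u n + \<psi> * (e + e * e * (b' n / D u n))"
    by (simp add: algebra_simps)
  have nz': "phi m n - \<psi> \<noteq> 0" using nz(3) by (simp add: \<psi>_def)
  have "improved a b a' b' m w n - u n =
      (phi m n * u_plus a b a' b' w n - \<psi> * w n - (phi m n - \<psi>) * u n) / (phi m n - \<psi>)"
    using nz' by (simp add: improved_def \<psi>_def[symmetric] field_simps)
  also have "phi m n * u_plus a b a' b' w n - \<psi> * w n - (phi m n - \<psi>) * u n =
      \<psi> * ((phi m n * e - (w n - u n)) + phi m n * (e * e) * (b' n / D u n))"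
    unfolding diff by (simp add: algebra_simps)
  finally show ?thesis by (simp add: e_def \<psi>_def)
qed

text \<open>The exponents add up. The linear part of the error identity has order
  \<open>r - m / 2 - s\<close>, the quadratic part \<open>r - m - v\<close>; comparing each with
  \<open>- m / 2 - \<theta>\<close> gives the two conditions on \<theta>.\<close>

lemma improved_bigo:
  fixes a b a' b' w u :: "nat \<Rightarrow> complex"
  defines "D \<equiv> \<lambda>v n. a (n + 1) + b' n * b (n + 1) + b' n * v (n + 1)"
  assumes tail: "\<forall>\<^sub>F n in sequentially. cf_tail_value (two_variant a a') (two_variant b b') (2 * n - 1) (u n)"
    and err: "(\<lambda>n. w n - u n) \<in> O(npow (- (real m / 2)))"
    and shift: "(\<lambda>n. phi m n * (w (n + 1) - u (n + 1)) - (w n - u n)) \<in> O(npow (- (real m / 2) - s))"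
    and nz: "\<forall>\<^sub>F n in sequentially. D u n \<noteq> 0" "\<forall>\<^sub>F n in sequentially. D w n \<noteq> 0"
      "\<forall>\<^sub>F n in sequentially. phi m n \<noteq> psi a b a' b' w n"
    and quot: "(\<lambda>n. psi a b a' b' w n / (phi m n - psi a b a' b' w n)) \<in> O(npow r)"
    and den: "(\<lambda>n. b' n / D u n) \<in> O(npow (- v))"
    and \<theta>: "\<theta> \<le> s - r" "\<theta> \<le> real m / 2 + v - r"
  shows "(\<lambda>n. improved a b a' b' m w n - u n) \<in> O(npow (- (real m / 2) - \<theta>))"
proof -
  define e where "e n = w n - u n" for n
  have "(\<lambda>n. e (n + 1)) \<in> O(\<lambda>n. npow (- (real m / 2)) (n + 1))"
    by (rule landau_o.big.compose[OF err[folded e_def]]) (rule filterlim_add_const_nat_at_top)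
  then have e1: "(\<lambda>n. e (n + 1)) \<in> O(npow (- (real m / 2)))"
    using npow_shift_bigo by (rule landau_o.big_trans)
  have phi: "phi m \<in> O(\<lambda>_. 1)"
    using phi_tendsto_1 by (intro bigoI_tendsto[where c = 1]) auto
  define E where "E n = phi m n * (e (n + 1) * e (n + 1)) * (b' n / D u n)" for n
  have "E \<in> O(\<lambda>n. 1 * (npow (- (real m / 2)) n * npow (- (real m / 2)) n) * npow (- v) n)"
    unfolding E_def by (intro landau_o.big.mult phi e1 den)
  also have "(\<lambda>n. 1 * (npow (- (real m / 2)) n * npow (- (real m / 2)) n) * npow (- v) n)
      = npow (- real m - v)"
    by (simp add: fun_eq_iff flip: powr_add of_real_mult)
  finally have E: "E \<in> O(npow (- real m - v))" .
  have "(\<lambda>n. psi a b a' b' w n / (phi m n - psi a b a' b' w n) *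
      (phi m n * (w (n + 1) - u (n + 1)) - (w n - u n))) \<in> O(\<lambda>n. npow r n * npow (- (real m / 2) - s) n)"
    by (intro landau_o.big.mult quot shift)
  also have "(\<lambda>n. npow r n * npow (- (real m / 2) - s) n) = npow (r - real m / 2 - s)"
    unfolding npow_mult by (simp add: algebra_simps)
  also have "npow (r - real m / 2 - s) \<in> O(npow (- (real m / 2) - \<theta>))"
    using \<theta> by (intro npow_mono_bigo) auto
  finally have 1: "(\<lambda>n. psi a b a' b' w n / (phi m n - psi a b a' b' w n) *
      (phi m n * (w (n + 1) - u (n + 1)) - (w n - u n))) \<in> O(npow (- (real m / 2) - \<theta>))" .
  have "(\<lambda>n. psi a b a' b' w n / (phi m n - psi a b a' b' w n) * E n) \<in> O(\<lambda>n. npow r n * npow (- real m - v) n)"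
    by (intro landau_o.big.mult quot E)
  also have "(\<lambda>n. npow r n * npow (- real m - v) n) = npow (r - real m - v)"
    unfolding npow_mult by (simp add: algebra_simps)
  also have "npow (r - real m - v) \<in> O(npow (- (real m / 2) - \<theta>))"
    using \<theta> by (intro npow_mono_bigo) auto
  finally have 2: "(\<lambda>n. psi a b a' b' w n / (phi m n - psi a b a' b' w n) * E n)
      \<in> O(npow (- (real m / 2) - \<theta>))" .
  have tail1: "\<forall>\<^sub>F n in sequentially. cf_tail_value (two_variant a a') (two_variant b b') (2 * (n + 1) - 1) (u (n + 1))"
    using eventually_compose_filterlim[OF tail filterlim_add_const_nat_at_top[of 1]] .
  have "\<forall>\<^sub>F n in sequentially. improved a b a' b' m w n - u n =
      psi a b a' b' w n / (phi m n - psi a b a' b' w n) *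
      (phi m n * (w (n + 1) - u (n + 1)) - (w n - u n))
      + psi a b a' b' w n / (phi m n - psi a b a' b' w n) * E n"
    using tail tail1 nz eventually_gt_at_top[of 0]
  proof eventually_elim
    case (elim n)
    have "u n = a' n * (b (n + 1) + u (n + 1)) / D u n"
      using tail_value_recurrence[OF elim(1,6,2)] elim(3) by (simp add: D_def)
    from improved_minus_tail[OF this[unfolded D_def] elim(3,4)[unfolded D_def] elim(5)]
    show ?case by (simp add: E_def e_def D_def distrib_left)
  qed
  then show ?thesis
    using sum_in_bigo(1)[OF 1 2] by (simp only: landau_o.big.in_cong)
qed

text \<open>Used with the tail as well as with its approximation for \<open>v\<close>, so that the
  denominators of both have the same leading behaviour.\<close>

lemma denominator_tendsto:
  fixes a b b' v g h :: "nat \<Rightarrow> complex"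
  assumes gh: "\<forall>\<^sub>F n in sequentially. g n \<noteq> 0 \<and> h n \<noteq> 0"
    and lims: "(\<lambda>n. a (n + 1) / (g n * h n)) \<longlonglongrightarrow> A"
      "(\<lambda>n. b (n + 1) / g n) \<longlonglongrightarrow> B" "(\<lambda>n. b' n / h n) \<longlonglongrightarrow> B'"
      "(\<lambda>n. g n / g (n + 1)) \<longlonglongrightarrow> 1"
    and v: "(\<lambda>n. v n / g n) \<longlonglongrightarrow> x"
  shows "(\<lambda>n. v (n + 1) / g n) \<longlonglongrightarrow> x"
    and "(\<lambda>n. (a (n + 1) + b' n * b (n + 1) + b' n * v (n + 1)) / (g n * h n)) \<longlonglongrightarrow> A + B' * B + B' * x"
proof -
  have g1: "\<forall>\<^sub>F n in sequentially. g (n + 1) \<noteq> 0"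
    using eventually_compose_filterlim[OF gh filterlim_add_const_nat_at_top[of 1]] by eventually_elim auto
  have "(\<lambda>n. v (n + 1) / g (n + 1) / (g n / g (n + 1))) \<longlonglongrightarrow> x / 1"
    using filterlim_compose[OF v filterlim_add_const_nat_at_top[of 1]] by (intro tendsto_intros lims) auto
  moreover have "\<forall>\<^sub>F n in sequentially. v (n + 1) / g (n + 1) / (g n / g (n + 1)) = v (n + 1) / g n"
    using gh g1 by eventually_elim simp
  ultimately have "(\<lambda>n. v (n + 1) / g n) \<longlonglongrightarrow> x / 1" by (rule Lim_transform_eventually)
  then show v1: "(\<lambda>n. v (n + 1) / g n) \<longlonglongrightarrow> x" by simp
  have "(\<lambda>n. a (n + 1) / (g n * h n) + (b' n / h n) * (b (n + 1) / g n) + (b' n / h n) * (v (n + 1) / g n))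
      \<longlonglongrightarrow> A + B' * B + B' * x"
    by (intro tendsto_intros lims v1)
  then show "(\<lambda>n. (a (n + 1) + b' n * b (n + 1) + b' n * v (n + 1)) / (g n * h n)) \<longlonglongrightarrow> A + B' * B + B' * x"
    by (simp add: add_divide_distrib mult.commute)
qed

text \<open>The error is bounded while the scale grows.\<close>

lemma approximation_same_leading:
  assumes u: "(\<lambda>n. u n / npow \<gamma> n) \<longlonglongrightarrow> x" and "\<gamma> > 0"
    and err: "(\<lambda>n. w n - u n) \<in> O(npow (- (real m / 2)))"
  shows "(\<lambda>n. w n / npow \<gamma> n) \<longlonglongrightarrow> x"
proof -
  have "(\<lambda>n. (w n - u n) * npow (- \<gamma>) n) \<in> O(\<lambda>n. npow (- (real m / 2)) n * npow (- \<gamma>) n)"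
    by (intro landau_o.big.mult err) auto
  then have "(\<lambda>n. (w n - u n) * npow (- \<gamma>) n) \<in> O(npow (- (real m / 2) - \<gamma>))"
    by (simp add: npow_mult del: of_real_mult)
  then have "(\<lambda>n. (w n - u n) * npow (- \<gamma>) n) \<longlonglongrightarrow> 0"
    by (rule bigo_npow_tendsto_0) (use \<open>\<gamma> > 0\<close> in \<open>simp add: add_pos_nonneg\<close>)
  from tendsto_add[OF u this] show ?thesis by (simp add: npow_minus diff_divide_distrib)
qed

section \<open>Improvement in the loxodromic and in the parabolic regime\<close>

text \<open>\<open>psi\<close> tends to the multiplier at the attracting fixed point, of modulus
  below 1, so \<open>phi - psi\<close> stays away from 0. The order \<open>r\<close> of
  \<open>psi\<close> is taken from the product of \<open>a\<close> and \<open>a'\<close> by a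
  separate limit \<open>E\<close>, since \<open>A * A'\<close> may vanish; a negative
  \<open>r\<close> improves the result.\<close>

lemma loxodromic_improved:
  fixes a b a' b' w u :: "nat \<Rightarrow> complex"
  assumes tail: "\<forall>\<^sub>F n in sequentially. cf_tail_value (two_variant a a') (two_variant b b') (2 * n - 1) (u n)"
    and lims: "(\<lambda>n. a (n + 1) * npow (- (\<gamma> + \<eta>)) n) \<longlonglongrightarrow> A" "(\<lambda>n. a' n * npow (- (\<gamma> + \<eta>)) n) \<longlonglongrightarrow> A'"
      "(\<lambda>n. b (n + 1) * npow (- \<gamma>) n) \<longlonglongrightarrow> B" "(\<lambda>n. b' n * npow (- \<eta>) n) \<longlonglongrightarrow> B'"
    and "\<gamma> > 0" "x0 \<noteq> x1"
    and roots: "A' * (B + x0) = x0 * (A + B' * B + B' * x0)"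
      "A' * (B + x1) = x1 * (A + B' * B + B' * x1)"
    and less: "norm (A + B' * B + B' * x1) < norm (A + B' * B + B' * x0)"
    and err: "(\<lambda>n. w n - u n) \<in> O(npow (- (real m / 2)))"
    and shift: "(\<lambda>n. phi m n * (w (n + 1) - u (n + 1)) - (w n - u n)) \<in> O(npow (- (real m / 2) - s))"
    and E: "(\<lambda>n. a (n + 1) * a' n * npow (- (2 * (\<gamma> + \<eta>)) - r) n) \<longlonglongrightarrow> E"
    and \<theta>: "\<theta> \<le> s - r" "\<theta> \<le> real m / 2 + \<gamma> - r"
  shows "(\<lambda>n. improved a b a' b' m w n - u n) \<in> O(npow (- (real m / 2) - \<theta>))"
proof -
  define g where "g = npow \<gamma>"
  define h where "h = npow \<eta>"
  have gh_eq: "g n * h n = npow (\<gamma> + \<eta>) n" for n by (simp add: g_def h_def powr_add)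
  have gh: "\<forall>\<^sub>F n in sequentially. g n \<noteq> 0 \<and> h n \<noteq> 0"
    unfolding g_def h_def by (rule eventually_npow_nonzero)
  have lims': "(\<lambda>n. a (n + 1) / (g n * h n)) \<longlonglongrightarrow> A" "(\<lambda>n. a' n / (g n * h n)) \<longlonglongrightarrow> A'"
      "(\<lambda>n. b (n + 1) / g n) \<longlonglongrightarrow> B" "(\<lambda>n. b' n / h n) \<longlonglongrightarrow> B'"
      "(\<lambda>n. g n / g (n + 1)) \<longlonglongrightarrow> 1"
    using lims npow_ratio[of \<gamma>] unfolding gh_eq unfolding g_def h_def npow_minus by simp_all
  define D0 where "D0 = A + B' * B + B' * x0"
  define D1 where "D1 = A + B' * B + B' * x1"
  have D0: "D0 \<noteq> 0" using less by (auto simp: D0_def)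
  have "D0 * D1 = A * A'"
    using fixed_point_denominators_prod[OF \<open>x0 \<noteq> x1\<close> roots] by (simp add: D0_def D1_def)
  then have \<Psi>: "A * A' / D0\<^sup>2 = D1 / D0" using D0 by (simp add: power2_eq_square field_simps)
  have \<Psi>1: "1 - A * A' / D0\<^sup>2 \<noteq> 0"
    using less D0 unfolding \<Psi> by (auto simp: D0_def[symmetric] D1_def[symmetric])
  have ug: "(\<lambda>n. u n / g n) \<longlonglongrightarrow> x0"
    by (rule tail_limit_loxodromic[OF tail gh lims' \<open>x0 \<noteq> x1\<close> roots less])
  have wg: "(\<lambda>n. w n / g n) \<longlonglongrightarrow> x0"
    using approximation_same_leading[OF ug[unfolded g_def] \<open>\<gamma> > 0\<close> err] by (simp add: g_def)
  define D where "D v n = a (n + 1) + b' n * b (n + 1) + b' n * v (n + 1)" for v n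
  have Du: "(\<lambda>n. D u n / (g n * h n)) \<longlonglongrightarrow> D0" and Dw: "(\<lambda>n. D w n / (g n * h n)) \<longlonglongrightarrow> D0"
    unfolding D_def D0_def
    by (rule denominator_tendsto[OF gh lims'(1,3,4,5) ug] denominator_tendsto[OF gh lims'(1,3,4,5) wg])+
  have nz: "\<forall>\<^sub>F n in sequentially. D u n \<noteq> 0" "\<forall>\<^sub>F n in sequentially. D w n \<noteq> 0"
    using tendsto_imp_eventually_ne[OF Du D0] tendsto_imp_eventually_ne[OF Dw D0]
    by (auto elim: eventually_mono)
  define \<psi> where "\<psi> = psi a b a' b' w"
  have \<psi>: "\<forall>\<^sub>F n in sequentially. (a (n + 1) / (g n * h n)) * (a' n / (g n * h n)) / (D w n / (g n * h n))\<^sup>2 = \<psi> n"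
    using gh by eventually_elim (simp add: \<psi>_def psi_def D_def power2_eq_square)
  have "(\<lambda>n. (a (n + 1) / (g n * h n)) * (a' n / (g n * h n)) / (D w n / (g n * h n))\<^sup>2) \<longlonglongrightarrow> A * A' / D0\<^sup>2"
    using D0 by (intro tendsto_intros lims' Dw) auto
  then have \<psi>lim: "\<psi> \<longlonglongrightarrow> A * A' / D0\<^sup>2" using \<psi> by (rule Lim_transform_eventually)
  have diff: "(\<lambda>n. phi m n - \<psi> n) \<longlonglongrightarrow> 1 - A * A' / D0\<^sup>2"
    by (intro tendsto_intros phi_tendsto_1 \<psi>lim)
  have nz3: "\<forall>\<^sub>F n in sequentially. phi m n \<noteq> \<psi> n"
    using tendsto_imp_eventually_ne[OF diff \<Psi>1] by eventually_elim simp
  have quot: "(\<lambda>n. \<psi> n / (phi m n - \<psi> n)) \<in> O(npow r)"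
  proof (rule bigo_npowI)
    have "(\<lambda>n. a (n + 1) * a' n * npow (- (2 * (\<gamma> + \<eta>)) - r) n / (D w n / (g n * h n))\<^sup>2 / (phi m n - \<psi> n))
        \<longlonglongrightarrow> E / D0\<^sup>2 / (1 - A * A' / D0\<^sup>2)"
      using D0 \<Psi>1 by (intro tendsto_intros E Dw diff) auto
    moreover have "\<forall>\<^sub>F n in sequentially.
        a (n + 1) * a' n * npow (- (2 * (\<gamma> + \<eta>)) - r) n / (D w n / (g n * h n))\<^sup>2 / (phi m n - \<psi> n)
        = \<psi> n / (phi m n - \<psi> n) * npow (- r) n"
      using \<psi>
    proof eventually_elim
      case (elim n)
      have "npow (- (2 * (\<gamma> + \<eta>)) - r) n = npow (- r) n / (g n * h n) / (g n * h n)"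
      proof -
        have "npow (- (2 * (\<gamma> + \<eta>)) - r) n = npow (- r) n * npow (- (\<gamma> + \<eta>)) n * npow (- (\<gamma> + \<eta>)) n"
          unfolding npow_mult by (simp add: algebra_simps)
        then show ?thesis unfolding gh_eq npow_minus[of n "\<gamma> + \<eta>"] by simp
      qed
      then show ?case unfolding elim[symmetric] by simp
    qed
    ultimately show "(\<lambda>n. \<psi> n / (phi m n - \<psi> n) * npow (- r) n)
        \<longlonglongrightarrow> E / D0\<^sup>2 / (1 - A * A' / D0\<^sup>2)"
      by (rule Lim_transform_eventually)
  qed
  have den: "(\<lambda>n. b' n / D u n) \<in> O(npow (- \<gamma>))"
  proof (rule bigo_npowI)
    have "(\<lambda>n. b' n / h n / (D u n / (g n * h n))) \<longlonglongrightarrow> B' / D0"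
      by (intro tendsto_intros lims' Du D0)
    moreover have "\<forall>\<^sub>F n in sequentially. b' n / h n / (D u n / (g n * h n)) = b' n / D u n * npow (- (- \<gamma>)) n"
      using gh by eventually_elim (simp add: g_def)
    ultimately show "(\<lambda>n. b' n / D u n * npow (- (- \<gamma>)) n) \<longlonglongrightarrow> B' / D0"
      by (rule Lim_transform_eventually)
  qed
  show ?thesis
    by (rule improved_bigo[OF tail err shift nz[unfolded D_def] nz3[unfolded \<psi>_def]
        quot[unfolded \<psi>_def] den[unfolded D_def] \<theta>])
qed

text \<open>The principal root has nonnegative real part, and a purely imaginary root has a
  nonpositive real square.\<close>

lemma Re_csqrt_pos:
  assumes "z \<notin> \<real>\<^sub>\<le>\<^sub>0"
  shows "Re (csqrt z) > 0"
proof (rule ccontr)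
  assume "\<not> Re (csqrt z) > 0"
  then have "Re (csqrt z) = 0" using csqrt_principal[of z] by auto
  then have "csqrt z = \<i> * of_real (Im (csqrt z))" by (simp add: complex_eq_iff)
  then have "z = (\<i> * of_real (Im (csqrt z)))\<^sup>2" by (metis power2_csqrt)
  also have "\<dots> = of_real (- (Im (csqrt z))\<^sup>2)" by (simp add: power_mult_distrib)
  finally show False using assms by (metis nonpos_Reals_of_real_iff neg_le_0_iff_le zero_le_power2)
qed

text \<open>Both \<open>phi\<close> and \<open>psi\<close> tend to 1, so their difference is needed
  to the next order: multiplied by \<open>npow \<gamma>\<close> it tends to
  \<open>M + R + \<kappa>\<close>, which has positive real part. Division by it costs \<gamma>
  powers of \<open>n\<close>, while \<open>b' / D\<close> contributes \<open>2 * \<gamma>\<close>;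
  hence the two conditions on \<theta>.\<close>

lemma parabolic_improved:
  fixes a b a' b' w u :: "nat \<Rightarrow> complex" and R M \<gamma> :: real
  assumes tail: "\<forall>\<^sub>F n in sequentially. cf_tail_value (two_variant a a') (two_variant b b') (2 * n - 1) (u n)"
    and \<gamma>: "0 < \<gamma>" "\<gamma> \<le> 1"
    and lims: "(\<lambda>n. (a (n + 1) * npow (- (2 * \<gamma>)) n - A) * npow \<gamma> n) \<longlonglongrightarrow> A1"
      "(\<lambda>n. (a' n * npow (- (2 * \<gamma>)) n - A) * npow \<gamma> n) \<longlonglongrightarrow> A1'"
      "(\<lambda>n. b (n + 1)) \<longlonglongrightarrow> B" "b' \<longlonglongrightarrow> B'"
    and R: "(\<lambda>n. (1 - npow \<gamma> n / npow \<gamma> (n + 1)) * npow \<gamma> n) \<longlonglongrightarrow> of_real R" "R \<ge> 0"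
    and M: "(\<lambda>n. (phi m n - 1) * npow \<gamma> n) \<longlonglongrightarrow> of_real M" "M \<ge> 0"
    and nz: "A \<noteq> 0" "B' \<noteq> 0"
    and disc: "((A1 - A1' - A * of_real R)\<^sup>2 + 4 * A * B * B') / A\<^sup>2 \<notin> \<real>\<^sub>\<le>\<^sub>0"
    and err: "(\<lambda>n. w n - u n) \<in> O(npow (- (real m / 2)))"
    and shift: "(\<lambda>n. phi m n * (w (n + 1) - u (n + 1)) - (w n - u n)) \<in> O(npow (- (real m / 2) - s))"
    and \<theta>: "\<theta> \<le> s - \<gamma>" "\<theta> \<le> real m / 2 + \<gamma>"
  shows "(\<lambda>n. improved a b a' b' m w n - u n) \<in> O(npow (- (real m / 2) - \<theta>))"
proof -
  define N where "N = npow \<gamma>"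
  define t where "t n = real n powr (- \<gamma>)" for n
  have t_eq: "complex_of_real (t n) = 1 / N n" for n
    by (simp add: t_def N_def powr_minus_divide)
  have N2: "N n * N n = npow (2 * \<gamma>) n" for n by (simp add: N_def flip: powr_add of_real_mult)
  have Nnz: "\<forall>\<^sub>F n in sequentially. N n \<noteq> 0"
    unfolding N_def using eventually_gt_at_top[of 0] by eventually_elim simp
  have gh: "\<forall>\<^sub>F n in sequentially. N n \<noteq> 0 \<and> N n \<noteq> 0" using Nnz by simp
  have t: "t \<longlonglongrightarrow> 0" using \<gamma> unfolding t_def by real_asymp
  have t': "\<forall>\<^sub>F n in sequentially. 1 / real n \<le> t n"
    using eventually_ge_at_top[of 1]
  proof eventually_elim
    case (elim n)
    have "real n powr (-1) \<le> t n" unfolding t_def using elim \<gamma> by (intro powr_mono) auto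
    then show ?case using elim by (simp add: powr_minus_divide)
  qed
  have N0: "(\<lambda>n. 1 / N n) \<longlonglongrightarrow> 0"
    using tendsto_of_real[OF t, where 'a = complex] unfolding t_eq by simp
  have bN: "(\<lambda>n. b (n + 1) / N n) \<longlonglongrightarrow> 0" and b'N: "(\<lambda>n. b' n / N n) \<longlonglongrightarrow> 0"
    using tendsto_mult[OF lims(3) N0] tendsto_mult[OF lims(4) N0] by simp_all
  define \<alpha> where "\<alpha> n = a (n + 1) / (N n * N n)" for n
  define \<alpha>' where "\<alpha>' n = a' n / (N n * N n)" for n
  have \<alpha>1: "(\<lambda>n. (\<alpha> n - A) * N n) \<longlonglongrightarrow> A1" and \<alpha>'1: "(\<lambda>n. (\<alpha>' n - A) * N n) \<longlonglongrightarrow> A1'"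
    using lims(1,2) unfolding \<alpha>_def \<alpha>'_def N2 npow_minus by (simp_all add: N_def)
  have to0: "f \<longlonglongrightarrow> l" if "(\<lambda>n. (f n - l) * N n) \<longlonglongrightarrow> k" for f :: "nat \<Rightarrow> complex" and l k
  proof -
    have "(\<lambda>n. (f n - l) * N n * (1 / N n) + l) \<longlonglongrightarrow> k * 0 + l"
      by (intro tendsto_intros that N0)
    moreover have "\<forall>\<^sub>F n in sequentially. (f n - l) * N n * (1 / N n) + l = f n"
      using Nnz by eventually_elim simp
    ultimately have "f \<longlonglongrightarrow> k * 0 + l" by (rule Lim_transform_eventually)
    then show ?thesis by simp
  qed
  have \<alpha>: "\<alpha> \<longlonglongrightarrow> A" and \<alpha>': "\<alpha>' \<longlonglongrightarrow> A" using to0[OF \<alpha>1] to0[OF \<alpha>'1] .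
  have scaled: "(\<lambda>n. (a (n + 1) / (N n * N n) - A) / of_real (t n)) \<longlonglongrightarrow> A1"
      "(\<lambda>n. (a' n / (N n * N n) - A) / of_real (t n)) \<longlonglongrightarrow> A1'"
      "(\<lambda>n. (1 - N n / N (n + 1)) / of_real (t n)) \<longlonglongrightarrow> of_real R"
    using \<alpha>1 \<alpha>'1 R(1) unfolding \<alpha>_def \<alpha>'_def t_eq by (simp_all add: N_def)
  have scaled_b: "(\<lambda>n. b (n + 1) / N n / of_real (t n)) \<longlonglongrightarrow> B" "(\<lambda>n. b' n / N n / of_real (t n)) \<longlonglongrightarrow> B'"
  proof -
    have "\<forall>\<^sub>F n in sequentially. b (n + 1) = b (n + 1) / N n / of_real (t n)"
      "\<forall>\<^sub>F n in sequentially. b' n = b' n / N n / of_real (t n)"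
      using Nnz unfolding t_eq by (auto elim: eventually_mono)
    then show "(\<lambda>n. b (n + 1) / N n / of_real (t n)) \<longlonglongrightarrow> B" "(\<lambda>n. b' n / N n / of_real (t n)) \<longlonglongrightarrow> B'"
      using lims(3,4) by (auto intro: Lim_transform_eventually)
  qed
  define \<beta> where "\<beta> = A1 - A1' - A * of_real R"
  \<comment> \<open>The principal root has positive real part by \<open>disc\<close>; this selects
    the attracting one of the two roots.\<close>
  define \<kappa> where "\<kappa> = csqrt ((\<beta>\<^sup>2 + 4 * A * B * B') / A\<^sup>2)"
  have Re: "Re \<kappa> > 0" using Re_csqrt_pos[OF disc] by (simp add: \<kappa>_def \<beta>_def)
  have \<kappa>2: "(A * \<kappa>)\<^sup>2 = \<beta>\<^sup>2 + 4 * A * B * B'" using nz by (simp add: \<kappa>_def power_mult_distrib)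
  \<comment> \<open>The signs are such that \<open>B' * (x0 - x1) = A * \<kappa>\<close>.\<close>
  define x0 where "x0 = (- \<beta> + A * \<kappa>) / (2 * B')"
  define x1 where "x1 = (- \<beta> - A * \<kappa>) / (2 * B')"
  have x: "2 * B' * x0 = - \<beta> + A * \<kappa>" "2 * B' * x1 = - \<beta> - A * \<kappa>" using nz by (simp_all add: x0_def x1_def)
  have root: "B' * y\<^sup>2 + \<beta> * y = A * B" if "(2 * B' * y + \<beta>)\<^sup>2 = \<beta>\<^sup>2 + 4 * A * B * B'" for y
  proof -
    have "4 * B' * (B' * y\<^sup>2 + \<beta> * y - A * B) = 0" using that by algebra
    then show ?thesis using nz by simp
  qed
  have roots: "B' * x0\<^sup>2 + (A1 - A1' - A * of_real R) * x0 = A * B"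
      "B' * x1\<^sup>2 + (A1 - A1' - A * of_real R) * x1 = A * B"
    unfolding \<beta>_def[symmetric] by (rule root, use x \<kappa>2 in \<open>simp add: power2_eq_square\<close>)+
  have "B' * (x0 - x1) = A * \<kappa>" using x by algebra
  then have \<kappa>_eq: "B' * (x0 - x1) / A = \<kappa>" using nz by simp
  then have Re': "Re (B' * (x0 - x1) / A) > 0" using Re by simp
  then have "x0 \<noteq> x1" by auto
  have ug: "(\<lambda>n. u n / N n) \<longlonglongrightarrow> x0"
    by (rule tail_limit_parabolic[OF tail gh t t' scaled(1,2) scaled_b scaled(3) nz(1) \<open>x0 \<noteq> x1\<close> roots Re'])
  have wg: "(\<lambda>n. w n / N n) \<longlonglongrightarrow> x0"
    using approximation_same_leading[OF ug[unfolded N_def] \<gamma>(1) err] by (simp add: N_def)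
  define D where "D v n = a (n + 1) + b' n * b (n + 1) + b' n * v (n + 1)" for v n
  have ratio: "(\<lambda>n. N n / N (n + 1)) \<longlonglongrightarrow> 1" unfolding N_def by (rule npow_ratio)
  have Du: "(\<lambda>n. D u n / (N n * N n)) \<longlonglongrightarrow> A"
    using denominator_tendsto(2)[OF gh \<alpha>[unfolded \<alpha>_def] bN b'N ratio ug] by (simp add: D_def)
  have Dw: "(\<lambda>n. D w n / (N n * N n)) \<longlonglongrightarrow> A"
    using denominator_tendsto(2)[OF gh \<alpha>[unfolded \<alpha>_def] bN b'N ratio wg] by (simp add: D_def)
  have w1: "(\<lambda>n. w (n + 1) / N n) \<longlonglongrightarrow> x0"
    using denominator_tendsto(1)[OF gh \<alpha>[unfolded \<alpha>_def] bN b'N ratio wg] .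
  have Dnz: "\<forall>\<^sub>F n in sequentially. D u n \<noteq> 0" "\<forall>\<^sub>F n in sequentially. D w n \<noteq> 0"
    using tendsto_imp_eventually_ne[OF Du nz(1)] tendsto_imp_eventually_ne[OF Dw nz(1)]
    by (auto elim: eventually_mono)
  define d where "d n = D w n / (N n * N n)" for n
  have d: "d \<longlonglongrightarrow> A" using Dw by (simp add: d_def[abs_def])
  \<comment> \<open>First correction of the denominator: the product of \<open>b'\<close> and
    \<open>b\<close> is of lower order here, whereas \<open>b' * w\<close> contributes through the
    limit \<open>x0\<close>.\<close>
  have d1: "(\<lambda>n. (d n - A) * N n) \<longlonglongrightarrow> A1 + B' * x0"
  proof -
    have "(\<lambda>n. (\<alpha> n - A) * N n + b' n * (b (n + 1) / N n) + b' n * (w (n + 1) / N n)) \<longlonglongrightarrow> A1 + B' * 0 + B' * x0"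
      by (intro tendsto_intros lims \<alpha>1 bN w1)
    moreover have "\<forall>\<^sub>F n in sequentially. (\<alpha> n - A) * N n + b' n * (b (n + 1) / N n) + b' n * (w (n + 1) / N n)
        = (d n - A) * N n"
      using Nnz by eventually_elim (simp add: d_def D_def \<alpha>_def add_divide_distrib algebra_simps)
    ultimately have "(\<lambda>n. (d n - A) * N n) \<longlonglongrightarrow> A1 + B' * 0 + B' * x0" by (rule Lim_transform_eventually)
    then show ?thesis by simp
  qed
  define \<psi> where "\<psi> = psi a b a' b' w"
  have \<psi>: "\<forall>\<^sub>F n in sequentially. \<alpha> n * \<alpha>' n / (d n)\<^sup>2 = \<psi> n"
    using Nnz by eventually_elim (simp add: \<psi>_def psi_def d_def D_def \<alpha>_def \<alpha>'_def power2_eq_square)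
  have "(\<lambda>n. \<alpha> n * \<alpha>' n / (d n)\<^sup>2) \<longlonglongrightarrow> A * A / A\<^sup>2"
    using nz by (intro tendsto_intros \<alpha> \<alpha>' d) auto
  then have "\<psi> \<longlonglongrightarrow> A * A / A\<^sup>2" using \<psi> by (rule Lim_transform_eventually)
  then have \<psi>lim: "\<psi> \<longlonglongrightarrow> 1" using nz by (simp add: power2_eq_square)
  define K where "K = of_real M + of_real R + \<kappa>"
  have "K \<noteq> 0" using Re R(2) M(2) by (auto simp: K_def complex_eq_iff)
  have M': "(\<lambda>n. (phi m n - 1) * N n) \<longlonglongrightarrow> of_real M" using M(1) by (simp add: N_def)
  have diff: "(\<lambda>n. (phi m n - \<psi> n) * N n) \<longlonglongrightarrow> K"
  proof -
    have "(\<lambda>n. (phi m n - 1) * N n + ((d n - A) * N n * (d n + A) - (\<alpha> n - A) * N n * \<alpha>' n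
        - A * ((\<alpha>' n - A) * N n)) / (d n)\<^sup>2)
      \<longlonglongrightarrow> of_real M + ((A1 + B' * x0) * (A + A) - A1 * A - A * A1') / A\<^sup>2"
      using nz by (intro tendsto_intros \<alpha>1 \<alpha>'1 \<alpha>' d d1 M') auto
    moreover have "\<forall>\<^sub>F n in sequentially. (phi m n - 1) * N n + ((d n - A) * N n * (d n + A)
        - (\<alpha> n - A) * N n * \<alpha>' n - A * ((\<alpha>' n - A) * N n)) / (d n)\<^sup>2 = (phi m n - \<psi> n) * N n"
      using \<psi> tendsto_imp_eventually_ne[OF d nz(1)]
    proof eventually_elim
      case (elim n)
      have "(d n - A) * N n * (d n + A) - (\<alpha> n - A) * N n * \<alpha>' n - A * ((\<alpha>' n - A) * N n) =
          ((d n)\<^sup>2 - \<alpha> n * \<alpha>' n) * N n"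
        by (simp add: power2_eq_square algebra_simps)
      moreover have "((d n)\<^sup>2 - X) * N n / (d n)\<^sup>2 = (1 - X / (d n)\<^sup>2) * N n" for X
        using elim(2) by (simp add: field_simps)
      ultimately have "((d n - A) * N n * (d n + A) - (\<alpha> n - A) * N n * \<alpha>' n - A * ((\<alpha>' n - A) * N n)) / (d n)\<^sup>2
          = (1 - \<psi> n) * N n"
        by (simp only: elim(1))
      then show ?case by (simp add: algebra_simps)
    qed
    ultimately have "(\<lambda>n. (phi m n - \<psi> n) * N n) \<longlonglongrightarrow>
        of_real M + ((A1 + B' * x0) * (A + A) - A1 * A - A * A1') / A\<^sup>2"
      by (rule Lim_transform_eventually)
    \<comment> \<open>Inserting \<open>2 * B' * x0 = - \<beta> + A * \<kappa>\<close> cancels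
      \<open>A1\<close> and \<open>A1'\<close>.\<close>
    moreover have "((A1 + B' * x0) * (A + A) - A1 * A - A * A1') / A\<^sup>2 = of_real R + \<kappa>"
    proof -
      have "(A1 + B' * x0) * (A + A) - A1 * A - A * A1' = A\<^sup>2 * (of_real R + \<kappa>)"
        using x(1) unfolding \<beta>_def by algebra
      then show ?thesis using nz by simp
    qed
    ultimately show ?thesis by (simp add: K_def add.assoc)
  qed
  have nz3: "\<forall>\<^sub>F n in sequentially. phi m n \<noteq> \<psi> n"
    using tendsto_imp_eventually_ne[OF diff \<open>K \<noteq> 0\<close>] by eventually_elim auto
  have quot: "(\<lambda>n. \<psi> n / (phi m n - \<psi> n)) \<in> O(npow \<gamma>)"
  proof (rule bigo_npowI)
    have "(\<lambda>n. \<psi> n / ((phi m n - \<psi> n) * N n)) \<longlonglongrightarrow> 1 / K"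
      by (intro tendsto_intros \<psi>lim diff \<open>K \<noteq> 0\<close>)
    then show "(\<lambda>n. \<psi> n / (phi m n - \<psi> n) * npow (- \<gamma>) n) \<longlonglongrightarrow> 1 / K"
      unfolding npow_minus by (simp add: N_def)
  qed
  have den: "(\<lambda>n. b' n / D u n) \<in> O(npow (- (2 * \<gamma>)))"
  proof (rule bigo_npowI)
    have "(\<lambda>n. b' n / (D u n / (N n * N n))) \<longlonglongrightarrow> B' / A"
      by (intro tendsto_intros lims Du nz)
    then show "(\<lambda>n. b' n / D u n * npow (- (- (2 * \<gamma>))) n) \<longlonglongrightarrow> B' / A"
      unfolding N2 by simp
  qed
  show ?thesis
    by (rule improved_bigo[OF tail err shift Dnz[unfolded D_def] nz3[unfolded \<psi>_def]
        quot[unfolded \<psi>_def] den[unfolded D_def]]) (use \<theta> in auto)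
qed

section \<open>The individual classes\<close>

text \<open>On the scale \<open>npow \<gamma>\<close> the denominators \<open>b\<close> vanish in
  the limit, and the limiting map is \<open>x \<mapsto> A' * x / (A + B' * x)\<close>. Its fixed
  points 0 and \<open>(A' - A) / B'\<close> have denominators \<open>A\<close> and
  \<open>A'\<close>; the larger modulus decides which one attracts.\<close>

lemma improved_different_moduli:
  fixes a b a' b' w u :: "nat \<Rightarrow> complex"
  assumes tail: "\<forall>\<^sub>F n in sequentially. cf_tail_value (two_variant a a') (two_variant b b') (2 * n - 1) (u n)"
    and "\<gamma> > 0"
    and a: "(\<lambda>n. a (n + 1) * npow (- \<gamma>) n) \<longlonglongrightarrow> A" and a': "(\<lambda>n. a' n * npow (- \<gamma>) n) \<longlonglongrightarrow> A'"
    and b: "(\<lambda>n. b (n + 1)) \<longlonglongrightarrow> B" and b': "b' \<longlonglongrightarrow> B'"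
    and "B' \<noteq> 0" "norm A' \<noteq> norm A"
    and err: "(\<lambda>n. w n - u n) \<in> O(npow (- (real m / 2)))"
    and shift: "(\<lambda>n. phi m n * (w (n + 1) - u (n + 1)) - (w n - u n)) \<in> O(npow (- (real m / 2) - 2))"
    and "2 \<le> real m / 2 + \<gamma>"
  shows "(\<lambda>n. improved a b a' b' m w n - u n) \<in> O(npow (- (real m / 2) - 2))"
proof -
  have B: "(\<lambda>n. b (n + 1) * npow (- \<gamma>) n) \<longlonglongrightarrow> 0"
    using tendsto_mult[OF b npow_tendsto_0[of "- \<gamma>"]] \<open>\<gamma> > 0\<close> by simp
  have B': "(\<lambda>n. b' n * npow (- 0) n) \<longlonglongrightarrow> B'"
  proof (rule Lim_transform_eventually[OF b'])
    show "\<forall>\<^sub>F n in sequentially. b' n = b' n * npow (- 0) n"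
      using eventually_gt_at_top[of 0] by eventually_elim simp
  qed
  have E: "(\<lambda>n. a (n + 1) * a' n * npow (- (2 * (\<gamma> + 0)) - 0) n) \<longlonglongrightarrow> A * A'"
  proof -
    have "npow (- (2 * (\<gamma> + 0)) - 0) n = npow (- \<gamma>) n * npow (- \<gamma>) n" for n
      unfolding npow_mult by simp
    then show ?thesis using tendsto_mult[OF a a'] by (simp add: mult_ac)
  qed
  define y where "y = (A' - A) / B'"
  have y: "B' * y = A' - A" "y \<noteq> 0" using \<open>B' \<noteq> 0\<close> \<open>norm A' \<noteq> norm A\<close> by (auto simp: y_def)
  note main = loxodromic_improved[OF tail, where \<gamma> = \<gamma> and \<eta> = 0 and r = 0 and s = 2 and \<theta> = 2 and w = w and m = m,
      unfolded add_0_right, OF a a' B B' \<open>\<gamma> > 0\<close> _ _ _ _ err shift E[unfolded add_0_right]]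
  consider "norm A' < norm A" | "norm A < norm A'" using \<open>norm A' \<noteq> norm A\<close> by linarith
  then show ?thesis
  proof cases
    case 1
    show ?thesis
      by (rule main[of 0 y]) (use 1 y \<open>2 \<le> _\<close> in \<open>auto simp: algebra_simps\<close>)
  next
    case 2
    show ?thesis
      by (rule main[of y 0]) (use 2 y \<open>2 \<le> _\<close> in \<open>auto simp: algebra_simps\<close>)
  qed
qed

text \<open>At a fixed point \<open>x\<close> with denominator \<open>D x\<close>,
  \<open>A' / B' - x = A * A' / (B' * D x)\<close>. Hence unequal distances from
  \<open>A' / B'\<close> mean unequal moduli of \<open>D\<close>, and the nearer root
  attracts.\<close>

lemma improved_D21_tilde:
  fixes a b a' b' w u :: "nat \<Rightarrow> complex"
  assumes tail: "\<forall>\<^sub>F n in sequentially. cf_tail_value (two_variant a a') (two_variant b b') (2 * n - 1) (u n)"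
    and a: "(\<lambda>n. a (n + 1) * npow (- 2) n) \<longlonglongrightarrow> A" and a': "(\<lambda>n. a' n * npow (- 2) n) \<longlonglongrightarrow> A'"
    and b: "(\<lambda>n. b (n + 1) * npow (- 1) n) \<longlonglongrightarrow> B" and b': "(\<lambda>n. b' n * npow (- 1) n) \<longlonglongrightarrow> B'"
    and nz: "B' \<noteq> 0"
    and roots: "{x. B + x \<noteq> 0 \<and> B' + A / (B + x) \<noteq> 0 \<and> x = A' / (B' + A / (B + x))} = {x0, x1}"
    and neq: "norm (A' / B' - x0) \<noteq> norm (A' / B' - x1)"
    and err: "(\<lambda>n. w n - u n) \<in> O(npow (- (real m / 2)))"
    and shift: "(\<lambda>n. phi m n * (w (n + 1) - u (n + 1)) - (w n - u n)) \<in> O(npow (- (real m / 2) - 2))"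
    and "2 \<le> m"
  shows "(\<lambda>n. improved a b a' b' m w n - u n) \<in> O(npow (- (real m / 2) - 2))"
proof -
  have E: "(\<lambda>n. a (n + 1) * a' n * npow (- (2 * 2) - 0) n) \<longlonglongrightarrow> A * A'"
  proof -
    have "npow (- (2 * 2) - 0) n = npow (- 2) n * npow (- 2) n" for n
      unfolding npow_mult by simp
    then show ?thesis using tendsto_mult[OF a a'] by (simp add: mult_ac)
  qed
  define D where "D x = A + B' * B + B' * x" for x
  have root: "A' * (B + x) = x * D x" "D x \<noteq> 0" "A' / B' - x = A * A' / (B' * D x)" if "x \<in> {x0, x1}" for x
  proof -
    have x: "B + x \<noteq> 0" "B' + A / (B + x) \<noteq> 0" "x = A' / (B' + A / (B + x))"
      using that unfolding roots[symmetric] by auto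
    have Dx: "D x = (B' + A / (B + x)) * (B + x)" using x(1) by (simp add: D_def field_simps)
    then show D: "D x \<noteq> 0" using x Dx by simp
    have "x * (B' + A / (B + x)) = A'" using x by (metis nonzero_eq_divide_eq)
    then show r: "A' * (B + x) = x * D x" using Dx by (metis mult.assoc)
    have "A' * D x - x * B' * D x = A * A'" using r unfolding D_def by algebra
    then show "A' / B' - x = A * A' / (B' * D x)" using D nz by (simp add: field_simps)
  qed
  have "norm (D x0) \<noteq> norm (D x1)"
    using neq root(3)[of x0] root(3)[of x1] by (auto simp: norm_divide norm_mult)
  note main = loxodromic_improved[OF tail, where \<gamma> = 1 and \<eta> = 1 and r = 0 and s = 2 and \<theta> = 2 and w = w and m = m,
      unfolded one_add_one, OF a a' b b' _ _ _ _ _ err shift E, folded D_def]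
  consider "norm (D x1) < norm (D x0)" | "norm (D x0) < norm (D x1)" using \<open>norm (D x0) \<noteq> _\<close> by linarith
  then show ?thesis
  proof cases
    case 1
    show ?thesis
      by (rule main[of x0 x1]) (use 1 root(1) \<open>2 \<le> m\<close> in auto)
  next
    case 2
    show ?thesis
      by (rule main[of x1 x0]) (use 2 root(1) \<open>2 \<le> m\<close> in auto)
  qed
qed

text \<open>On the scale \<open>n\<close> of the tails both numerators vanish in the limit. The
  limiting map is degenerate: 0 is the attracting point, and \<open>- B\<close>, where the
  denominator vanishes, is the other root of the cleared equation. Moreover \<open>psi\<close> is of
  order -2, which raises \<theta> from 2 to 4; the quadratic part allows this because
  \<open>m / 2 + 1 + 2 \<ge> 4\<close>.\<close>

lemma improved_D11:
  fixes a b a' b' w u :: "nat \<Rightarrow> complex"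
  assumes tail: "\<forall>\<^sub>F n in sequentially. cf_tail_value (two_variant a a') (two_variant b b') (2 * n - 1) (u n)"
    and a: "(\<lambda>n. a (n + 1) * npow (- 1) n) \<longlonglongrightarrow> A" and a': "(\<lambda>n. a' n * npow (- 1) n) \<longlonglongrightarrow> A'"
    and b: "(\<lambda>n. b (n + 1) * npow (- 1) n) \<longlonglongrightarrow> B" and b': "(\<lambda>n. b' n * npow (- 1) n) \<longlonglongrightarrow> B'"
    and nz: "B \<noteq> 0" "B' \<noteq> 0"
    and err: "(\<lambda>n. w n - u n) \<in> O(npow (- (real m / 2)))"
    and shift: "(\<lambda>n. phi m n * (w (n + 1) - u (n + 1)) - (w n - u n)) \<in> O(npow (- (real m / 2) - 2))"
    and "2 \<le> m"
  shows "(\<lambda>n. improved a b a' b' m w n - u n) \<in> O(npow (- (real m / 2) - 4))"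
proof -
  have split: "npow (- 2) n = npow (- 1) n * npow (- 1) n" for n unfolding npow_mult by simp
  have vanish: "(\<lambda>n. x n * npow (- 2) n) \<longlonglongrightarrow> 0" if "(\<lambda>n. x n * npow (- 1) n) \<longlonglongrightarrow> X" for x X
    using tendsto_mult[OF that npow_tendsto_0[of "- 1"]] unfolding split by (simp add: mult.assoc)
  have E: "(\<lambda>n. a (n + 1) * a' n * npow (- (2 * 2) - (- 2)) n) \<longlonglongrightarrow> A * A'"
  proof -
    have "npow (- (2 * 2) - (- 2)) n = npow (- 1) n * npow (- 1) n" for n
      unfolding npow_mult by simp
    then show ?thesis using tendsto_mult[OF a a'] by (simp add: mult_ac)
  qed
  show ?thesis
    by (rule loxodromic_improved[OF tail, where \<gamma> = 1 and \<eta> = 1 and r = "-2" and s = 2 and \<theta> = 4 and w = w and m = m,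
          unfolded one_add_one, OF vanish[OF a] vanish[OF a'] b b' _ _ _ _ _ err shift E, of 0 "- B"])
      (use nz \<open>2 \<le> m\<close> in auto)
qed

text \<open>The scale of the tails is the square root of \<open>n\<close>, whereas the elements, the
  scale itself and \<open>phi\<close> vary by relative order \<open>1 / n\<close>. So all the
  first-order constants \<open>A1\<close>, \<open>A1'\<close>, \<open>R\<close> and \<open>M\<close>
  are 0.\<close>

lemma improved_D10_eq:
  fixes a b a' b' w u :: "nat \<Rightarrow> complex"
  assumes tail: "\<forall>\<^sub>F n in sequentially. cf_tail_value (two_variant a a') (two_variant b b') (2 * n - 1) (u n)"
    and exps: "elem_expansion (\<lambda>n. a (n + 1)) p" "elem_expansion a' p'"
      "elem_expansion (\<lambda>n. b (n + 1)) q" "elem_expansion b' q'"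
    and D: "class_D10_eq p p' q q'"
    and err: "(\<lambda>n. w n - u n) \<in> O(npow (- (real m / 2)))"
    and shift: "(\<lambda>n. phi m n * (w (n + 1) - u (n + 1)) - (w n - u n)) \<in> O(npow (- (real m / 2) - 3/2))"
    and "1 \<le> m"
  shows "(\<lambda>n. improved a b a' b' m w n - u n) \<in> O(npow (- (real m / 2) - 1))"
proof -
  have lead: "leading p 1" "leading p' 1" "leading q 0" "leading q' 0"
    and eq: "p (-1) = p' (-1)" and neg: "q 0 * q' 0 / p (-1) \<notin> \<real>\<^sub>\<le>\<^sub>0"
    using D unfolding class_D10_eq_def class_D_kl_def by blast+
  have nz: "p (-1) \<noteq> 0" "q' 0 \<noteq> 0" using lead by (simp_all add: leading_def)
  have half: "(\<lambda>n. f n * npow (1/2) n) \<longlonglongrightarrow> 0" if "(\<lambda>n. f n * of_nat n) \<longlonglongrightarrow> k" for f :: "nat \<Rightarrow> complex" and k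
  proof -
    have "(\<lambda>n. f n * of_nat n * npow (- 1/2) n) \<longlonglongrightarrow> k * 0"
      by (intro tendsto_mult that npow_tendsto_0) simp
    moreover have "\<forall>\<^sub>F n in sequentially. f n * of_nat n * npow (- 1/2) n = f n * npow (1/2) n"
      using eventually_gt_at_top[of 0]
    proof eventually_elim
      case (elim n)
      have "of_nat n * npow (- 1/2) n = npow (1/2) n"
        using npow_mult[of n 1 "- 1/2"] elim by simp
      then show ?case by (simp add: mult.assoc)
    qed
    ultimately have "(\<lambda>n. f n * npow (1/2) n) \<longlonglongrightarrow> k * 0" by (rule Lim_transform_eventually)
    then show ?thesis by simp
  qed
  have \<phi>: "(\<lambda>n. (phi m n - 1) * of_nat n) \<longlonglongrightarrow> of_nat m / 2"
    by (rule Lim_transform_eventually[OF tendsto_const])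
      (use eventually_gt_at_top[of 0] in \<open>eventually_elim, simp add: phi_def\<close>)
  \<comment> \<open>With these constants 0 the discriminant is four times the number in the class
    condition, and a positive factor does not affect the excluded half-line.\<close>
  have disc: "((0 - 0 - p (-1) * of_real 0)\<^sup>2 + 4 * p (-1) * q 0 * q' 0) / (p (-1))\<^sup>2 \<notin> \<real>\<^sub>\<le>\<^sub>0"
  proof -
    have "((0 - 0 - p (-1) * of_real 0)\<^sup>2 + 4 * p (-1) * q 0 * q' 0) / (p (-1))\<^sup>2
        = of_real 4 * (q 0 * q' 0 / p (-1))"
      using nz by (simp add: power2_eq_square)
    moreover have "of_real 4 * z \<in> \<real>\<^sub>\<le>\<^sub>0 \<Longrightarrow> z \<in> \<real>\<^sub>\<le>\<^sub>0" for z :: complex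
      by (auto simp: complex_nonpos_Reals_iff)
    ultimately show ?thesis using neg by metis
  qed
  have two_half: "2 * (1/2::real) = 1" by simp
  show ?thesis
  proof (rule parabolic_improved[OF tail, where \<gamma> = "1/2" and R = 0 and M = 0 and s = "3/2", unfolded two_half,
        OF _ _ half half _ _ _ _ _ _ nz disc err shift])
    show "(\<lambda>n. (a (n + 1) * npow (- 1) n - p (-1)) * of_nat n) \<longlonglongrightarrow> p 0"
      by (rule expansion_order_1[OF exps(1) lead(1)])
    show "(\<lambda>n. (a' n * npow (- 1) n - p (-1)) * of_nat n) \<longlonglongrightarrow> p' 0"
      unfolding eq by (rule expansion_order_1[OF exps(2) lead(2)])
    show "(\<lambda>n. b (n + 1)) \<longlonglongrightarrow> q 0" "b' \<longlonglongrightarrow> q' 0"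
      using expansion_order_0[OF exps(3) lead(3)] expansion_order_0[OF exps(4) lead(4)] by auto
    show "(\<lambda>n. (1 - npow (1/2) n / npow (1/2) (n + 1)) * npow (1/2) n) \<longlonglongrightarrow> of_real 0"
      using half[OF npow_ratio'[of "1/2"]] by simp
    show "(\<lambda>n. (phi m n - 1) * npow (1/2) n) \<longlonglongrightarrow> of_real 0"
      using half[OF \<phi>] by simp
  qed (use \<open>1 \<le> m\<close> in auto)
qed

text \<open>The scale is now \<open>n\<close>, so corrections of relative order \<open>1 / n\<close>
  count: \<open>A1\<close> and \<open>A1'\<close> are the second coefficients of \<open>a\<close>
  and \<open>a'\<close>, \<open>R = 1\<close> is the drift of the scale, and
  \<open>M = m / 2\<close> comes from \<open>phi\<close>.\<close>

lemma improved_D20_eq: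
  fixes a b a' b' w u :: "nat \<Rightarrow> complex"
  assumes tail: "\<forall>\<^sub>F n in sequentially. cf_tail_value (two_variant a a') (two_variant b b') (2 * n - 1) (u n)"
    and exps: "elem_expansion (\<lambda>n. a (n + 1)) p" "elem_expansion a' p'"
      "elem_expansion (\<lambda>n. b (n + 1)) q" "elem_expansion b' q'"
    and D: "class_D20_eq p p' q q'"
    and err: "(\<lambda>n. w n - u n) \<in> O(npow (- (real m / 2)))"
    and shift: "(\<lambda>n. phi m n * (w (n + 1) - u (n + 1)) - (w n - u n)) \<in> O(npow (- (real m / 2) - 2))"
  shows "(\<lambda>n. improved a b a' b' m w n - u n) \<in> O(npow (- (real m / 2) - 1))"
proof -
  have lead: "leading p 2" "leading p' 2" "leading q 0" "leading q' 0"
    and eq: "p (-2) = p' (-2)"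
    and neg: "((p (-1) - p' (-1) - p (-2))\<^sup>2 - 4 * q' 0 * (- p (-2) * q 0)) / (p (-2))\<^sup>2 \<notin> \<real>\<^sub>\<le>\<^sub>0"
    using D unfolding class_D20_eq_def class_D_kl_def Let_def by blast+
  have nz: "p (-2) \<noteq> 0" "q' 0 \<noteq> 0" using lead by (simp_all add: leading_def)
  have npow_1: "npow 1 n = of_nat n" for n by simp
  have \<phi>: "(\<lambda>n. (phi m n - 1) * of_nat n) \<longlonglongrightarrow> of_real (real m / 2)"
    by (rule Lim_transform_eventually[OF tendsto_const])
      (use eventually_gt_at_top[of 0] in \<open>eventually_elim, simp add: phi_def\<close>)
  \<comment> \<open>The drift constant 1 accounts for the summand \<open>- p (-2)\<close> in \<beta>
    of the class condition.\<close>
  have disc: "((p (-1) - p' (-1) - p (-2) * of_real 1)\<^sup>2 + 4 * p (-2) * q 0 * q' 0) / (p (-2))\<^sup>2 \<notin> \<real>\<^sub>\<le>\<^sub>0"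
    using neg by (simp add: mult_ac)
  show ?thesis
  proof (rule parabolic_improved[OF tail, where \<gamma> = 1 and R = 1 and M = "real m / 2" and s = 2, unfolded mult_1_right,
        OF _ _ _ _ _ _ _ _ _ _ nz disc[unfolded mult_1_right] err shift])
    show "(\<lambda>n. (a (n + 1) * npow (- 2) n - p (-2)) * npow 1 n) \<longlonglongrightarrow> p (-1)"
      unfolding npow_1 by (rule expansion_order_2[OF exps(1) lead(1)])
    show "(\<lambda>n. (a' n * npow (- 2) n - p (-2)) * npow 1 n) \<longlonglongrightarrow> p' (-1)"
      unfolding eq npow_1 by (rule expansion_order_2[OF exps(2) lead(2)])
    show "(\<lambda>n. b (n + 1)) \<longlonglongrightarrow> q 0" "b' \<longlonglongrightarrow> q' 0"
      using expansion_order_0[OF exps(3) lead(3)] expansion_order_0[OF exps(4) lead(4)] by auto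
    show "(\<lambda>n. (1 - npow 1 n / npow 1 (n + 1)) * npow 1 n) \<longlonglongrightarrow> of_real 1"
      using npow_ratio'[of 1] by simp
    show "(\<lambda>n. (phi m n - 1) * npow 1 n) \<longlonglongrightarrow> of_real (real m / 2)"
      unfolding npow_1 by (rule \<phi>)
  qed auto
qed

section \<open>Case distinction over the classes\<close>

theorem theorem3p1:
  fixes a b a' b' :: "nat \<Rightarrow> complex"
    and p p' q q' :: "int \<Rightarrow> complex"
    and u u' :: "nat \<Rightarrow> complex"
    and c :: complex and m :: nat
  assumes "elem_expansion (\<lambda>n. a (n + 1)) p"
    and "elem_expansion a' p'"
    and "elem_expansion (\<lambda>n. b (n + 1)) q"
    and "elem_expansion b' q'"
    and "class_D p p' q q'"
    and "\<exists>f. cf_converges_to (two_variant a a') (two_variant b b') f"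
    and "\<forall>\<^sub>F n in sequentially. cf_tail_value (two_variant a a') (two_variant b b') (2 * n - 1) (u n)"
    and "c \<noteq> 0"
    and "m \<ge> m_min p p' q q'"
    and "(\<lambda>n. u' n - u n - c * npow (- (real m / 2)) n) \<in> O(npow (- ((real m + 1) / 2)))"
    and "error_expansion (class_D10_eq p p' q q') u' u c m"
  shows "(\<lambda>n. improved a b a' b' m u' n - u n) \<in> O(npow (- (real m / 2) - theta p p' q q'))"
proof -
  note exps = assms(1-4)
  note tail = assms(7)
  have err: "(\<lambda>n. u' n - u n) \<in> O(npow (- (real m / 2)))"
  proof -
    have "(\<lambda>n. u' n - u n - c * npow (- (real m / 2)) n) \<in> O(npow (- (real m / 2)))"
      using assms(10) npow_mono_bigo[of "- ((real m + 1) / 2)" "- (real m / 2)"]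
      by (auto intro: landau_o.big_trans)
    then have "(\<lambda>n. u' n - u n - c * npow (- (real m / 2)) n + c * npow (- (real m / 2)) n)
        \<in> O(npow (- (real m / 2)))"
      by (rule sum_in_bigo) simp
    then show ?thesis by simp
  qed
  note shift = error_shift[OF assms(11)]
  consider (eq1) "class_D10_eq p p' q q'" | (eq2) "class_D20_eq p p' q q'"
    | (neq1) "class_D10_neq p p' q q'" | (neq2) "class_D20_neq p p' q q'"
    | (tilde) "class_D21_tilde p p' q q'" | (D11) "class_D11 p p' q q'"
    using assms(5) unfolding class_D_def by blast
  then show ?thesis
  proof cases
    case eq1
    \<comment> \<open>\<open>theta\<close> and \<open>m_min\<close> are nested conditionals, so
      competing classes must be excluded; here \<open>p (-2)\<close> does it, being 0 for
      \<open>k = 1\<close> and nonzero for \<open>k = 2\<close>.\<close>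
    then have "theta p p' q q' = 1" "1 \<le> m"
      using assms(9) by (auto simp: theta_def m_min_def class_D10_eq_def class_D20_eq_def class_D20_neq_def
          class_D_kl_def leading_def)
    moreover have "(\<lambda>n. phi m n * (u' (n + 1) - u (n + 1)) - (u' n - u n)) \<in> O(npow (- (real m / 2) - 3/2))"
      using shift eq1 by simp
    ultimately show ?thesis using improved_D10_eq[OF tail exps eq1 err] by simp
  next
    case eq2
    then have "theta p p' q q' = 1" "\<not> class_D10_eq p p' q q'"
      by (auto simp: theta_def class_D10_eq_def class_D20_eq_def class_D_kl_def leading_def)
    then show ?thesis using improved_D20_eq[OF tail exps eq2 err] shift by simp
  next
    case neq1
    then have lead: "leading p 1" "leading p' 1" "leading q 0" "leading q' 0" "norm (p' (-1)) \<noteq> norm (p (-1))"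
      by (simp_all add: class_D10_neq_def class_D_kl_def)
    \<comment> \<open>The unequal moduli contradict the first class, and \<open>p (-2) = 0\<close>
      the other two.\<close>
    have not: "\<not> class_D10_eq p p' q q'" "\<not> class_D20_eq p p' q q'" "\<not> class_D20_neq p p' q q'"
      using lead by (auto simp: class_D10_eq_def class_D20_eq_def class_D20_neq_def class_D_kl_def leading_def)
    then have "theta p p' q q' = 2" "2 \<le> m" using neq1 assms(9) by (simp_all add: theta_def m_min_def)
    moreover have "(\<lambda>n. phi m n * (u' (n + 1) - u (n + 1)) - (u' n - u n)) \<in> O(npow (- (real m / 2) - 2))"
      using shift not by simp
    moreover have "q' 0 \<noteq> 0" using lead by (simp add: leading_def)
    ultimately show ?thesis
      using improved_different_moduli[OF tail _ expansion_order_1(1)[OF exps(1) lead(1)]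
          expansion_order_1(1)[OF exps(2) lead(2)] expansion_order_0[OF exps(3) lead(3)]
          expansion_order_0[OF exps(4) lead(4)] _ lead(5) err] by simp
  next
    case neq2
    then have lead: "leading p 2" "leading p' 2" "leading q 0" "leading q' 0" "norm (p' (-2)) \<noteq> norm (p (-2))"
      by (simp_all add: class_D20_neq_def class_D_kl_def)
    have not: "\<not> class_D10_eq p p' q q'" "\<not> class_D20_eq p p' q q'"
      using lead by (auto simp: class_D10_eq_def class_D20_eq_def class_D_kl_def leading_def)
    then have "theta p p' q q' = 2" using neq2 by (simp add: theta_def)
    moreover have "(\<lambda>n. phi m n * (u' (n + 1) - u (n + 1)) - (u' n - u n)) \<in> O(npow (- (real m / 2) - 2))"
      using shift not by simp
    moreover have "q' 0 \<noteq> 0" using lead by (simp add: leading_def)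
    ultimately show ?thesis
      using improved_different_moduli[OF tail _ expansion_order_2(1)[OF exps(1) lead(1)]
          expansion_order_2(1)[OF exps(2) lead(2)] expansion_order_0[OF exps(3) lead(3)]
          expansion_order_0[OF exps(4) lead(4)] _ lead(5) err] by simp
  next
    case tilde
    then have lead: "leading p 2" "leading p' 2" "leading q 1" "leading q' 1"
      by (simp_all add: class_D21_tilde_def class_D_kl_def)
    obtain x0 x1 where x: "{x. q (-1) + x \<noteq> 0 \<and> q' (-1) + p (-2) / (q (-1) + x) \<noteq> 0 \<and>
                  x = p' (-2) / (q' (-1) + p (-2) / (q (-1) + x))} = {x0, x1}"
      "norm (p' (-2) / q' (-1) - x0) \<noteq> norm (p' (-2) / q' (-1) - x1)"
      using tilde by (auto simp: class_D21_tilde_def)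
    have not: "\<not> class_D10_eq p p' q q'" "\<not> class_D20_eq p p' q q'" "\<not> class_D20_neq p p' q q'"
      using lead by (auto simp: class_D10_eq_def class_D20_eq_def class_D20_neq_def class_D_kl_def leading_def)
    then have "theta p p' q q' = 2" "2 \<le> m" using tilde assms(9) by (simp_all add: theta_def m_min_def)
    moreover have "(\<lambda>n. phi m n * (u' (n + 1) - u (n + 1)) - (u' n - u n)) \<in> O(npow (- (real m / 2) - 2))"
      using shift not by simp
    moreover have "q' (-1) \<noteq> 0" using lead by (simp add: leading_def)
    ultimately show ?thesis
      using improved_D21_tilde[OF tail expansion_order_2(1)[OF exps(1) lead(1)]
          expansion_order_2(1)[OF exps(2) lead(2)] expansion_order_1(1)[OF exps(3) lead(3)]
          expansion_order_1(1)[OF exps(4) lead(4)] _ x err] by simp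
  next
    case D11
    then have lead: "leading p 1" "leading p' 1" "leading q 1" "leading q' 1"
      by (simp_all add: class_D11_def class_D_kl_def)
    \<comment> \<open>Classes with \<open>l = 0\<close> contradict \<open>q (-1) \<noteq> 0\<close>,
      and those with \<open>k = 2\<close> contradict \<open>p (-2) = 0\<close>.\<close>
    have not: "\<not> class_D10_eq p p' q q'" "\<not> class_D20_eq p p' q q'" "\<not> class_D20_neq p p' q q'"
      "\<not> class_D10_neq p p' q q'" "\<not> class_D21_tilde p p' q q'"
      using lead by (auto simp: class_D10_eq_def class_D20_eq_def class_D20_neq_def class_D10_neq_def
          class_D21_tilde_def class_D_kl_def leading_def)
    then have "theta p p' q q' = 4" "2 \<le> m" using assms(9) by (simp_all add: theta_def m_min_def)
    moreover have "(\<lambda>n. phi m n * (u' (n + 1) - u (n + 1)) - (u' n - u n)) \<in> O(npow (- (real m / 2) - 2))"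
      using shift not by simp
    moreover have "q (-1) \<noteq> 0" "q' (-1) \<noteq> 0" using lead by (simp_all add: leading_def)
    ultimately show ?thesis
      using improved_D11[OF tail expansion_order_1(1)[OF exps(1) lead(1)]
          expansion_order_1(1)[OF exps(2) lead(2)] expansion_order_1(1)[OF exps(3) lead(3)]
          expansion_order_1(1)[OF exps(4) lead(4)] _ _ err] by simp
  qed
qed

end
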